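(* Let $\Delta=(\delta_i:i\in I)$ be a type such that $|I|\le 2$. Then the finite maximal antichains in the homomorphism order $\mathcal C(\Delta)$ are exactly the sets $$\mathcal Q=\mathcal F\cup\{D\in\mathcal D: D\not\to F\text{ for any }F\in\mathcal F\},$$ where $(\mathcal F,\mathcal D)$ is a finite homomorphism duality.
   Context: A type is a finite family $\Delta=(\delta_i:i\in I)$ of integers $\delta_i\ge 2$. A $\Delta$-structure $A$ consists of a finite non-empty base set $\underline{A}$ and relations $R_i(A)\subseteq\underline{A}^{\delta_i}$ ($i\in I$). A homomorphism $A\to B$ is a map of base sets mapping $R_i(A)$ into $R_i(B)$ for every $i\in I$; write $A\to B$ if one exists. $A,B$ are incomparable if $A\not\to B$ and $B\not\to A$. A core is a structure not homomorphic to any proper induced substructure of itself. The homomorphism order $\mathcal C(\Delta)$ is the set of isomorphism classes of core $\Delta$-structures partially ordered by $\to$ (every structure is homomorphically equivalent to a unique core and is identified with it). An antichain is a set of pairwise incomparable elements; it is maximal if it is not properly contained in another antichain. A finite homomorphism duality is a pair $(\mathcal F,\mathcal D)$ of finite sets of core $\Delta$-structures (taken up to isomorphism) such that distinct elements of $\mathcal F$ are incomparable, distinct elements of $\mathcal D$ are incomparable, and for every $\Delta$-structure $A$: there exists $F\in\mathcal F$ with $F\to A$ if and only if $A\not\to D$ for all $D\in\mathcal D$. *)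

theory Defs
  imports Main
begin

text \<open>A type is given by an index set \<open>I\<close> and an arity function \<open>\<delta>\<close> whose values outside \<open>I\<close>
  are irrelevant. Tuples are lists of the prescribed length.\<close>

datatype ('a, 'i) struct = Struct (base: "'a set") (rels: "'i \<Rightarrow> 'a list set")

definition is_structure :: "'i set \<Rightarrow> ('i \<Rightarrow> nat) \<Rightarrow> ('a, 'i) struct \<Rightarrow> bool" where
  "is_structure I \<delta> A \<longleftrightarrow>
     finite (base A) \<and> base A \<noteq> {} \<and>
     (\<forall>i\<in>I. rels A i \<subseteq> {xs. length xs = \<delta> i \<and> set xs \<subseteq> base A}) \<and>
     (\<forall>i. i \<notin> I \<longrightarrow> rels A i = {})"

definition is_hom :: "'i set \<Rightarrow> ('a \<Rightarrow> 'b) \<Rightarrow> ('a, 'i) struct \<Rightarrow> ('b, 'i) struct \<Rightarrow> bool" where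
  "is_hom I f A B \<longleftrightarrow> f ` base A \<subseteq> base B \<and> (\<forall>i\<in>I. map f ` rels A i \<subseteq> rels B i)"

definition hom_to :: "'i set \<Rightarrow> ('a, 'i) struct \<Rightarrow> ('b, 'i) struct \<Rightarrow> bool" where
  "hom_to I A B \<longleftrightarrow> (\<exists>f. is_hom I f A B)"

definition is_iso :: "'i set \<Rightarrow> ('a \<Rightarrow> 'b) \<Rightarrow> ('a, 'i) struct \<Rightarrow> ('b, 'i) struct \<Rightarrow> bool" where
  "is_iso I f A B \<longleftrightarrow> bij_betw f (base A) (base B) \<and> (\<forall>i\<in>I. map f ` rels A i = rels B i)"

definition induced :: "('a, 'i) struct \<Rightarrow> 'a set \<Rightarrow> ('a, 'i) struct" where
  "induced A S = Struct S (\<lambda>i. {xs \<in> rels A i. set xs \<subseteq> S})"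

definition is_core :: "'i set \<Rightarrow> ('a, 'i) struct \<Rightarrow> bool" where
  "is_core I A \<longleftrightarrow> \<not> (\<exists>S. S \<noteq> {} \<and> S \<subset> base A \<and> hom_to I A (induced A S))"

text \<open>Base sets are finite, so structures on finite sets of natural numbers represent all
  isomorphism classes.\<close>

definition iso_rel :: "'i set \<Rightarrow> ('i \<Rightarrow> nat) \<Rightarrow> ((nat, 'i) struct \<times> (nat, 'i) struct) set" where
  "iso_rel I \<delta> = {(A, B). is_structure I \<delta> A \<and> is_structure I \<delta> B \<and> (\<exists>f. is_iso I f A B)}"

definition iso_class :: "'i set \<Rightarrow> ('i \<Rightarrow> nat) \<Rightarrow> (nat, 'i) struct \<Rightarrow> (nat, 'i) struct set" where
  "iso_class I \<delta> A = iso_rel I \<delta> `` {A}"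

definition hom_order :: "'i set \<Rightarrow> ('i \<Rightarrow> nat) \<Rightarrow> (nat, 'i) struct set set" where
  "hom_order I \<delta> = {A. is_structure I \<delta> A \<and> is_core I A} // iso_rel I \<delta>"

definition class_hom :: "'i set \<Rightarrow> (nat, 'i) struct set \<Rightarrow> (nat, 'i) struct set \<Rightarrow> bool" where
  "class_hom I X Y \<longleftrightarrow> (\<exists>A\<in>X. \<exists>B\<in>Y. hom_to I A B)"

definition incomparable :: "'i set \<Rightarrow> (nat, 'i) struct set \<Rightarrow> (nat, 'i) struct set \<Rightarrow> bool" where
  "incomparable I X Y \<longleftrightarrow> \<not> class_hom I X Y \<and> \<not> class_hom I Y X"

definition antichain :: "'i set \<Rightarrow> ('i \<Rightarrow> nat) \<Rightarrow> (nat, 'i) struct set set \<Rightarrow> bool" where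
  "antichain I \<delta> Q \<longleftrightarrow> Q \<subseteq> hom_order I \<delta> \<and> pairwise (incomparable I) Q"

definition maximal_antichain :: "'i set \<Rightarrow> ('i \<Rightarrow> nat) \<Rightarrow> (nat, 'i) struct set set \<Rightarrow> bool" where
  "maximal_antichain I \<delta> Q \<longleftrightarrow> antichain I \<delta> Q \<and> \<not> (\<exists>Q'. antichain I \<delta> Q' \<and> Q \<subset> Q')"

definition finite_duality ::
  "'i set \<Rightarrow> ('i \<Rightarrow> nat) \<Rightarrow> (nat, 'i) struct set set \<Rightarrow> (nat, 'i) struct set set \<Rightarrow> bool" where
  "finite_duality I \<delta> \<F> \<D> \<longleftrightarrow>
     finite \<F> \<and> finite \<D> \<and> \<F> \<subseteq> hom_order I \<delta> \<and> \<D> \<subseteq> hom_order I \<delta> \<and>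
     pairwise (incomparable I) \<F> \<and> pairwise (incomparable I) \<D> \<and>
     (\<forall>A. is_structure I \<delta> A \<longrightarrow>
        ((\<exists>F\<in>\<F>. class_hom I F (iso_class I \<delta> A)) \<longleftrightarrow>
         (\<forall>D\<in>\<D>. \<not> class_hom I (iso_class I \<delta> A) D)))"

lemma hom_to_trans:
  assumes "hom_to I A B" and "hom_to I B C" shows "hom_to I A C"
proof -
  obtain f g where f: "is_hom I f A B" and g: "is_hom I g B C"
    using assms unfolding hom_to_def by blast
  have "is_hom I (g \<circ> f) A C" unfolding is_hom_def
  proof (intro conjI ballI)
    show "(g \<circ> f) ` base A \<subseteq> base C" using f g unfolding is_hom_def image_comp[symmetric] by blast
    fix i assume i: "i \<in> I"
    have "map f ` rels A i \<subseteq> rels B i" "map g ` rels B i \<subseteq> rels C i"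
      using f g i by (auto simp: is_hom_def)
    then have "map g ` map f ` rels A i \<subseteq> rels C i" by blast
    then show "map (g \<circ> f) ` rels A i \<subseteq> rels C i" by (simp add: image_image)
  qed
  then show ?thesis unfolding hom_to_def by blast
qed

lemma is_iso_imp_is_hom: "is_iso I f A B \<Longrightarrow> is_hom I f A B"
  by (auto simp: is_iso_def is_hom_def bij_betw_def)

lemma is_iso_inv:
  assumes A: "is_structure I \<delta> A" and f: "is_iso I f A B"
  shows "is_iso I (inv_into (base A) f) B A"
proof -
  let ?g = "inv_into (base A) f"
  have bij: "bij_betw f (base A) (base B)" using f by (simp add: is_iso_def)
  have "map ?g ` rels B i = rels A i" if i: "i \<in> I" for i
  proof -
    have B: "rels B i = map f ` rels A i" using f i by (simp add: is_iso_def)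
    have "map ?g (map f xs) = xs" if "xs \<in> rels A i" for xs
    proof -
      have "set xs \<subseteq> base A" using A i that unfolding is_structure_def by blast
      then show ?thesis using bij
        by (intro nth_equalityI) (auto simp: bij_betw_def subset_iff)
    qed
    then show ?thesis unfolding B image_image by (simp del: map_map cong: image_cong)
  qed
  then show ?thesis using bij by (simp add: is_iso_def bij_betw_inv_into)
qed

lemma is_iso_comp: "is_iso I f A B \<Longrightarrow> is_iso I g B C \<Longrightarrow> is_iso I (g \<circ> f) A C"
  unfolding is_iso_def by (metis bij_betw_trans image_comp map_comp_map)

lemma is_iso_id: "is_iso I id A A"
  by (simp add: is_iso_def)

lemma equiv_iso_rel: "equiv {A. is_structure I \<delta> A} (iso_rel I \<delta>)"
proof (rule equivI)
  show "iso_rel I \<delta> \<subseteq> {A. is_structure I \<delta> A} \<times> {A. is_structure I \<delta> A}"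
    by (auto simp: iso_rel_def)
  show "refl_on {A. is_structure I \<delta> A} (iso_rel I \<delta>)"
    by (auto simp: refl_on_def iso_rel_def intro: is_iso_id)
  show "sym (iso_rel I \<delta>)"
    by (auto simp: sym_def iso_rel_def intro: is_iso_inv)
  show "trans (iso_rel I \<delta>)"
    by (auto simp: trans_def iso_rel_def intro: is_iso_comp)
qed

lemma class_hom_iso_class:
  assumes "is_structure I \<delta> A" and "is_structure I \<delta> B"
  shows "class_hom I (iso_class I \<delta> A) (iso_class I \<delta> B) \<longleftrightarrow> hom_to I A B"
proof
  assume "class_hom I (iso_class I \<delta> A) (iso_class I \<delta> B)"
  then obtain A' B' :: "(nat, _) struct" and f g
    where f: "is_iso I f A A'" and g: "is_iso I g B B'" and h: "hom_to I A' B'"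
    by (auto simp: class_hom_def iso_class_def iso_rel_def)
  have "hom_to I A A'" using is_iso_imp_is_hom[OF f] unfolding hom_to_def by blast
  moreover have "hom_to I B' B"
    using is_iso_imp_is_hom[OF is_iso_inv[OF assms(2) g]] unfolding hom_to_def by blast
  ultimately show "hom_to I A B" using h hom_to_trans by blast
next
  assume "hom_to I A B"
  moreover have "A \<in> iso_class I \<delta> A" "B \<in> iso_class I \<delta> B"
    using assms is_iso_id by (auto simp: iso_class_def iso_rel_def)
  ultimately show "class_hom I (iso_class I \<delta> A) (iso_class I \<delta> B)"
    unfolding class_hom_def by blast
qed

end

theory Submission
  imports Defs "HOL-Library.Nat_Bijection"
begin

text \<open>
  One inclusion is formal. If \<open>(\<F>, \<D>)\<close> is a duality, every structure lies above a member of \<open>\<F>\<close>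
  or below a member of \<open>\<D>\<close>, and a member of \<open>\<D>\<close> that lies below some \<open>F \<in> \<F>\<close> may be replaced by
  \<open>F\<close> (\<open>duality_maximal_antichain\<close>).

  Conversely let \<open>Q\<close> be a finite maximal antichain and let \<open>\<F>\<close> consist of its members that are
  homomorphically equivalent to forests. Mapping a rooted tree to a structure is a recursive condition
  on vertices, so the obstructions to it are described by types of vertices: forests have finite duals
  (\<open>forest_set_duality\<close>). Let \<open>\<D>\<close> be the set of maximal duals of \<open>\<F>\<close>. Members of \<open>Q\<close> outside \<open>\<F>\<close>
  lie below \<open>\<D>\<close>, and everything follows once each \<open>D \<in> \<D>\<close> that is not below a forest of \<open>Q\<close> is
  known to belong to \<open>Q\<close> (\<open>maximal_dual_in_family\<close>).

  If such a \<open>D\<close> is not in \<open>Q\<close>, it is below no member of \<open>Q\<close>. By sparse incomparability there is a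
  structure \<open>X\<close> of large girth below \<open>D\<close> and still below no member of \<open>Q\<close>
  (\<open>sparse_incomparability\<close>). By maximality \<open>X\<close> is above some \<open>q \<in> Q\<close>, which is not a forest because
  the forests of \<open>Q\<close> are not below \<open>D\<close>. As \<open>q\<close> is small compared with the girth of \<open>X\<close>, it maps to a
  forest (\<open>sparse_factor\<close>).

  It remains to see that no non-forest \<open>q \<in> Q\<close> maps to a forest (\<open>no_potential\<close>), and this is where
  two relations are few enough. In a forest the vertices can be numbered so that all tuples become
  arithmetic progressions whose step depends on the relation only. If \<open>q\<close> is not a forest, it contains
  two junctions, that is, pairs of tuples sharing a vertex, that no two progressions can realise
  simultaneously (\<open>forestlike_or_junctions\<close>). Connecting these junctions by long folded chains in
  between gives a structure \<open>Z\<close> that has no such numbering although its small parts fold onto a single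
  junction (\<open>zigzag_no_potential\<close>, \<open>zigzag_local\<close>). With a sparse \<open>X\<close> below \<open>q\<close> and below no other
  member of \<open>Q\<close>, the sum \<open>X + Z\<close> is below no member of \<open>Q\<close>, and a member of \<open>Q\<close> below it would be
  below \<open>q\<close>, hence equal to \<open>q\<close>, and a forest.
\<close>

section \<open>Homomorphisms, copies, products and sums\<close>

lemma is_homI:
  assumes "\<And>v. v \<in> base A \<Longrightarrow> f v \<in> base B"
    and "\<And>i xs. i \<in> I \<Longrightarrow> xs \<in> rels A i \<Longrightarrow> map f xs \<in> rels B i"
  shows "is_hom I f A B"
  using assms unfolding is_hom_def by blast

lemma is_hom_base: "is_hom I f A B \<Longrightarrow> v \<in> base A \<Longrightarrow> f v \<in> base B"
  unfolding is_hom_def by blast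

lemma is_hom_rels: "is_hom I f A B \<Longrightarrow> i \<in> I \<Longrightarrow> xs \<in> rels A i \<Longrightarrow> map f xs \<in> rels B i"
  unfolding is_hom_def by blast

lemma is_hom_comp: "is_hom I f A B \<Longrightarrow> is_hom I g B C \<Longrightarrow> is_hom I (g \<circ> f) A C"
  by (rule is_homI) (auto dest: is_hom_base is_hom_rels simp flip: map_map)

lemma hom_to_refl: "hom_to I A A"
  unfolding hom_to_def by (rule exI[of _ id]) (auto intro: is_homI)

lemma is_structureD:
  assumes "is_structure I \<delta> A"
  shows "finite (base A)" "base A \<noteq> {}"
    and "xs \<in> rels A i \<Longrightarrow> i \<in> I" and "xs \<in> rels A i \<Longrightarrow> length xs = \<delta> i"
    and "xs \<in> rels A i \<Longrightarrow> set xs \<subseteq> base A"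
  using assms unfolding is_structure_def by (cases "i \<in> I"; blast)+

lemma is_structureI:
  assumes "finite (base A)" "base A \<noteq> {}"
    and "\<And>i xs. xs \<in> rels A i \<Longrightarrow> i \<in> I \<and> length xs = \<delta> i \<and> set xs \<subseteq> base A"
  shows "is_structure I \<delta> A"
  using assms unfolding is_structure_def by blast

text \<open>Only finiteness is intrinsic to a structure, so constructions may use any convenient vertex
  type and be moved to the natural numbers afterwards.\<close>
lemma nat_copy:
  fixes A :: "('a, 'i) struct"
  assumes "is_structure I \<delta> A"
  obtains N :: "(nat, 'i) struct" where "is_structure I \<delta> N" "hom_to I A N" "hom_to I N A"
proof -
  obtain f :: "'a \<Rightarrow> nat" where f: "inj_on f (base A)"
    using finite_imp_inj_to_nat_seg[OF is_structureD(1)[OF assms]] by blast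
  define N where "N = Struct (f ` base A) (\<lambda>i. map f ` rels A i)"
  have iso: "is_iso I f A N"
    using f by (auto simp: is_iso_def N_def bij_betw_def)
  have "is_structure I \<delta> N"
    using is_structureD[OF assms] by (intro is_structureI) (auto simp: N_def, blast)
  moreover have "hom_to I A N" "hom_to I N A"
    using is_iso_imp_is_hom[OF iso] is_iso_imp_is_hom[OF is_iso_inv[OF assms iso]]
    unfolding hom_to_def by blast+
  ultimately show thesis by (rule that)
qed

definition product :: "('a, 'i) struct \<Rightarrow> ('b, 'i) struct \<Rightarrow> ('a \<times> 'b, 'i) struct" where
  "product A B = Struct (base A \<times> base B) (\<lambda>i. {zs. map fst zs \<in> rels A i \<and> map snd zs \<in> rels B i})"

lemma product_structure:
  assumes A: "is_structure I \<delta> A" and B: "is_structure I \<delta> B"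
  shows "is_structure I \<delta> (product A B)"
proof (rule is_structureI)
  show "finite (base (product A B))" "base (product A B) \<noteq> {}"
    using is_structureD(1,2)[OF A] is_structureD(1,2)[OF B] by (auto simp: product_def)
  fix i zs assume z: "zs \<in> rels (product A B) i"
  then have a: "map fst zs \<in> rels A i" and b: "map snd zs \<in> rels B i" by (auto simp: product_def)
  have "set zs \<subseteq> base A \<times> base B"
    using is_structureD(5)[OF A a] is_structureD(5)[OF B b] by (force simp: subset_iff)
  then show "i \<in> I \<and> length zs = \<delta> i \<and> set zs \<subseteq> base (product A B)"
    using is_structureD(3,4)[OF A a] by (simp add: product_def)
qed

lemma hom_to_product: "hom_to I X (product A B) \<longleftrightarrow> hom_to I X A \<and> hom_to I X B"
proof
  assume "hom_to I X (product A B)"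
  then obtain f where f: "is_hom I f X (product A B)" unfolding hom_to_def by blast
  have "is_hom I (fst \<circ> f) X A" "is_hom I (snd \<circ> f) X B"
    using is_hom_base[OF f] is_hom_rels[OF f]
    by (auto intro!: is_homI simp: product_def mem_Times_iff)
  then show "hom_to I X A \<and> hom_to I X B" unfolding hom_to_def by blast
next
  assume "hom_to I X A \<and> hom_to I X B"
  then obtain f g where f: "is_hom I f X A" and g: "is_hom I g X B" unfolding hom_to_def by blast
  have "is_hom I (\<lambda>x. (f x, g x)) X (product A B)"
    using is_hom_base[OF f] is_hom_rels[OF f] is_hom_base[OF g] is_hom_rels[OF g]
    by (auto intro!: is_homI simp: product_def comp_def)
  then show "hom_to I X (product A B)" unfolding hom_to_def by blast
qed

definition dsum :: "('a, 'i) struct \<Rightarrow> ('b, 'i) struct \<Rightarrow> ('a + 'b, 'i) struct" where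
  "dsum A B = Struct (Inl ` base A \<union> Inr ` base B) (\<lambda>i. map Inl ` rels A i \<union> map Inr ` rels B i)"

lemma dsum_structure:
  assumes A: "is_structure I \<delta> A" and B: "is_structure I \<delta> B"
  shows "is_structure I \<delta> (dsum A B)"
proof (rule is_structureI)
  show "finite (base (dsum A B))" "base (dsum A B) \<noteq> {}"
    using is_structureD(1,2)[OF A] is_structureD(1,2)[OF B] by (auto simp: dsum_def)
  fix i zs assume z: "zs \<in> rels (dsum A B) i"
  then show "i \<in> I \<and> length zs = \<delta> i \<and> set zs \<subseteq> base (dsum A B)"
    using is_structureD(3-5)[OF A, of _ i] is_structureD(3-5)[OF B, of _ i]
    by (fastforce simp: dsum_def)
qed

lemma hom_to_dsum: "hom_to I (dsum A B) X \<longleftrightarrow> hom_to I A X \<and> hom_to I B X"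
proof
  assume "hom_to I (dsum A B) X"
  then obtain f where f: "is_hom I f (dsum A B) X" unfolding hom_to_def by blast
  have "map (f \<circ> Inl) xs \<in> rels X i" if "i \<in> I" "xs \<in> rels A i" for i xs
    using is_hom_rels[OF f that(1), of "map Inl xs"] that(2) by (simp add: dsum_def)
  moreover have "map (f \<circ> Inr) xs \<in> rels X i" if "i \<in> I" "xs \<in> rels B i" for i xs
    using is_hom_rels[OF f that(1), of "map Inr xs"] that(2) by (simp add: dsum_def)
  ultimately have "is_hom I (f \<circ> Inl) A X" "is_hom I (f \<circ> Inr) B X"
    using is_hom_base[OF f] by (auto intro!: is_homI simp: dsum_def)
  then show "hom_to I A X \<and> hom_to I B X" unfolding hom_to_def by blast
next
  assume "hom_to I A X \<and> hom_to I B X"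
  then obtain f g where f: "is_hom I f A X" and g: "is_hom I g B X" unfolding hom_to_def by blast
  have "is_hom I (case_sum f g) (dsum A B) X"
    using is_hom_base[OF f] is_hom_rels[OF f] is_hom_base[OF g] is_hom_rels[OF g]
    by (auto intro!: is_homI simp: dsum_def comp_def)
  then show "hom_to I (dsum A B) X" unfolding hom_to_def by blast
qed

section \<open>Rooted tree formulas and their duals\<close>

text \<open>A branch \<open>(i, j, ts)\<close> at a vertex demands a tuple of relation \<open>i\<close> with that vertex in position \<open>j\<close>
  and with the trees \<open>ts\<close> at all of its entries. The tree in position \<open>j\<close> of \<open>ts\<close> is demanded at the
  vertex itself, where the trivial tree \<open>Node []\<close> says nothing new.\<close>
datatype 'i rtree = Node (branches: "('i \<times> nat \<times> 'i rtree list) list")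

lemma rtree_induct [case_names Node]:
  assumes "\<And>bs. (\<And>i j ts t. (i, j, ts) \<in> set bs \<Longrightarrow> t \<in> set ts \<Longrightarrow> P t) \<Longrightarrow> P (Node bs)"
  shows "P t"
proof (induction t)
  case (Node bs)
  show ?case
  proof (rule assms)
    fix i j ts t assume "(i, j, ts) \<in> set bs" "t \<in> set ts"
    then show "P t" using Node.IH[of "(i, j, ts)" "(j, ts)" ts t] by simp
  qed
qed

inductive sat :: "('a, 'i) struct \<Rightarrow> 'a \<Rightarrow> 'i rtree \<Rightarrow> bool" for A where
  "(\<And>i j ts. (i, j, ts) \<in> set bs \<Longrightarrow>
      \<exists>xs\<in>rels A i. j < length xs \<and> xs ! j = a \<and> list_all2 (sat A) xs ts) \<Longrightarrow>
   sat A a (Node bs)"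
monos list.rel_mono_strong

lemma sat_Node:
  "sat A a (Node bs) \<longleftrightarrow>
    (\<forall>(i, j, ts)\<in>set bs. \<exists>xs\<in>rels A i. j < length xs \<and> xs ! j = a \<and> list_all2 (sat A) xs ts)"
  by (subst sat.simps) fastforce

lemma sat_branch:
  assumes "sat A a (Node bs)" "(i, j, ts) \<in> set bs"
  obtains xs where "xs \<in> rels A i" "j < length xs" "xs ! j = a" "list_all2 (sat A) xs ts"
  using bspec[OF assms(1)[unfolded sat_Node] assms(2)] that by auto

lemma sat_Node_iff_single: "sat A a (Node bs) \<longleftrightarrow> (\<forall>b\<in>set bs. sat A a (Node [b]))"
  by (auto simp: sat_Node)

lemma sat_hom:
  assumes f: "is_hom I f A B" and A: "is_structure I \<delta> A"
  shows "sat A a t \<Longrightarrow> sat B (f a) t"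
proof (induction t arbitrary: a rule: rtree_induct)
  case (Node bs)
  show ?case
  proof (rule sat.intros)
    fix i j ts assume b: "(i, j, ts) \<in> set bs"
    obtain xs where xs: "xs \<in> rels A i" "j < length xs" "xs ! j = a" "list_all2 (sat A) xs ts"
      using sat_branch[OF Node.prems b] .
    have "list_all2 (sat B) (map f xs) ts"
      unfolding list.rel_map using xs(4) by (rule list.rel_mono_strong) (rule Node.IH[OF b])
    then show "\<exists>ys\<in>rels B i. j < length ys \<and> ys ! j = f a \<and> list_all2 (sat B) ys ts"
      using xs(2,3) is_hom_rels[OF f is_structureD(3)[OF A xs(1)] xs(1)]
      by (intro bexI[of _ "map f xs"] conjI) simp_all
  qed
qed

definition models :: "('a, 'i) struct \<Rightarrow> 'i rtree set \<Rightarrow> bool" where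
  "models A Ts \<longleftrightarrow> (\<forall>t\<in>Ts. \<exists>a\<in>base A. sat A a t)"

lemma models_hom:
  assumes "hom_to I A B" and A: "is_structure I \<delta> A" and "models A Ts"
  shows "models B Ts"
  unfolding models_def
proof
  fix t assume "t \<in> Ts"
  then obtain a where a: "a \<in> base A" "sat A a t" using assms(3) unfolding models_def by blast
  obtain f where f: "is_hom I f A B" using assms(1) unfolding hom_to_def by blast
  show "\<exists>b\<in>base B. sat B b t"
    using is_hom_base[OF f a(1)] sat_hom[OF f A a(2)] by blast
qed

definition closed_branches :: "('i \<times> nat \<times> 'i rtree list) set \<Rightarrow> bool" where
  "closed_branches \<Phi> \<longleftrightarrow> (\<forall>(i, j, ts)\<in>\<Phi>. \<forall>t\<in>set ts. set (branches t) \<subseteq> \<Phi>)"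

lemma finite_closed_branches:
  "\<exists>\<Phi>. finite \<Phi> \<and> closed_branches \<Phi> \<and> set (branches t) \<subseteq> \<Phi>"
proof (induction t rule: rtree_induct)
  case (Node bs)
  let ?U = "\<Union>(i, j, ts)\<in>set bs. set ts"
  have "\<forall>t\<in>?U. \<exists>\<Phi>. finite \<Phi> \<and> closed_branches \<Phi> \<and> set (branches t) \<subseteq> \<Phi>"
    using Node.IH by fastforce
  then obtain \<Phi> where \<Phi>: "\<forall>t\<in>?U. finite (\<Phi> t) \<and> closed_branches (\<Phi> t) \<and> set (branches t) \<subseteq> \<Phi> t"
    by metis
  have "closed_branches (set bs \<union> (\<Union>t\<in>?U. \<Phi> t))"
    using \<Phi> unfolding closed_branches_def by fastforce
  moreover have "finite (set bs \<union> (\<Union>t\<in>?U. \<Phi> t))" using \<Phi> by auto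
  ultimately show ?case by (intro exI[of _ "set bs \<union> (\<Union>t\<in>?U. \<Phi> t)"]) auto
qed

text \<open>The dual of a rooted tree: its vertices are the sets of branches that a vertex may satisfy
  without satisfying the whole tree, and a tuple is allowed when it forces no further branch.\<close>
definition tree_dual :: "'i set \<Rightarrow> ('i \<Rightarrow> nat) \<Rightarrow> ('i \<times> nat \<times> 'i rtree list) set \<Rightarrow> 'i rtree \<Rightarrow>
    (('i \<times> nat \<times> 'i rtree list) set, 'i) struct" where
  "tree_dual I \<delta> \<Phi> t = Struct {S. S \<subseteq> \<Phi> \<and> \<not> set (branches t) \<subseteq> S}
    (\<lambda>i. {Ss. i \<in> I \<and> length Ss = \<delta> i \<and> set Ss \<subseteq> {S. S \<subseteq> \<Phi> \<and> \<not> set (branches t) \<subseteq> S} \<and>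
      (\<forall>j ts. (i, j, ts) \<in> \<Phi> \<longrightarrow> j < length Ss \<longrightarrow>
        list_all2 (\<lambda>S u. set (branches u) \<subseteq> S) Ss ts \<longrightarrow> (i, j, ts) \<in> Ss ! j)})"

text \<open>The tuples of the dual are closed under inference, so a vertex satisfies only trees whose branches
  it already lists.\<close>
lemma sat_tree_dual:
  assumes \<Phi>: "closed_branches \<Phi>"
  shows "sat (tree_dual I \<delta> \<Phi> t) S u \<Longrightarrow> set (branches u) \<subseteq> \<Phi> \<Longrightarrow> set (branches u) \<subseteq> S"
proof (induction u arbitrary: S rule: rtree_induct)
  case (Node bs)
  show ?case
  proof
    fix b assume "b \<in> set (branches (Node bs))"
    then obtain i j ts where b: "b = (i, j, ts)" "(i, j, ts) \<in> set bs"
      by (metis prod_cases3 rtree.sel)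
    obtain Ss where Ss: "Ss \<in> rels (tree_dual I \<delta> \<Phi> t) i" "j < length Ss" "Ss ! j = S"
        "list_all2 (sat (tree_dual I \<delta> \<Phi> t)) Ss ts"
      using sat_branch[OF Node.prems(1) b(2)] .
    have "(i, j, ts) \<in> \<Phi>" using Node.prems(2) b by auto
    then have sub: "u \<in> set ts \<Longrightarrow> set (branches u) \<subseteq> \<Phi>" for u
      using \<Phi> unfolding closed_branches_def by blast
    have "list_all2 (\<lambda>S u. set (branches u) \<subseteq> S) Ss ts"
      using Ss(4) by (rule list.rel_mono_strong) (rule Node.IH[OF b(2) _ _ sub])
    with Ss \<open>(i, j, ts) \<in> \<Phi>\<close> show "b \<in> S" by (auto simp: tree_dual_def b)
  qed
qed

text \<open>The homomorphism sends a vertex to the set of all branches it satisfies.\<close>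
lemma hom_to_tree_dual:
  assumes \<Phi>: "closed_branches \<Phi>" "set (branches t) \<subseteq> \<Phi>" and A: "is_structure I \<delta> A"
  shows "hom_to I A (tree_dual I \<delta> \<Phi> t) \<longleftrightarrow> \<not> (\<exists>a\<in>base A. sat A a t)"
proof
  assume "hom_to I A (tree_dual I \<delta> \<Phi> t)"
  then obtain f where f: "is_hom I f A (tree_dual I \<delta> \<Phi> t)" unfolding hom_to_def by blast
  show "\<not> (\<exists>a\<in>base A. sat A a t)"
  proof
    assume "\<exists>a\<in>base A. sat A a t"
    then obtain a where a: "a \<in> base A" "sat A a t" by blast
    have "sat (tree_dual I \<delta> \<Phi> t) (f a) t" using sat_hom[OF f A a(2)] .
    then have "set (branches t) \<subseteq> f a" using sat_tree_dual[OF \<Phi>(1)] \<Phi>(2) by blast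
    then show False using is_hom_base[OF f a(1)] by (simp add: tree_dual_def)
  qed
next
  assume no: "\<not> (\<exists>a\<in>base A. sat A a t)"
  define f where "f a = {b \<in> \<Phi>. sat A a (Node [b])}" for a
  have sat_f: "sat A a u \<longleftrightarrow> set (branches u) \<subseteq> f a" if "set (branches u) \<subseteq> \<Phi>" for a u
    using that sat_Node_iff_single[of A a "branches u"] by (auto simp: f_def)
  have base: "f a \<subseteq> \<Phi> \<and> \<not> set (branches t) \<subseteq> f a" if "a \<in> base A" for a
    using no sat_f[OF \<Phi>(2)] that by (auto simp: f_def)
  have "is_hom I f A (tree_dual I \<delta> \<Phi> t)"
  proof (rule is_homI)
    fix a assume "a \<in> base A"
    then show "f a \<in> base (tree_dual I \<delta> \<Phi> t)" using base by (simp add: tree_dual_def)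
  next
    fix i xs assume i: "i \<in> I" and xs: "xs \<in> rels A i"
    note xsD = is_structureD(3-5)[OF A xs]
    have "(i, j, ts) \<in> f (xs ! j)"
      if b: "(i, j, ts) \<in> \<Phi>" and j: "j < length xs"
        and l: "list_all2 (\<lambda>S u. set (branches u) \<subseteq> S) (map f xs) ts" for j ts
    proof -
      have "set (branches u) \<subseteq> \<Phi>" if "u \<in> set ts" for u
        using \<Phi>(1) b that unfolding closed_branches_def by blast
      then have "list_all2 (sat A) xs ts"
        using l sat_f by (auto simp: list_all2_conv_all_nth)
      then show ?thesis using b j xs by (auto simp: f_def sat_Node)
    qed
    then show "map f xs \<in> rels (tree_dual I \<delta> \<Phi> t) i"
      using i xsD base by (simp add: tree_dual_def) blast
  qed
  then show "hom_to I A (tree_dual I \<delta> \<Phi> t)" unfolding hom_to_def by blast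
qed

definition is_dual :: "'i set \<Rightarrow> ('i \<Rightarrow> nat) \<Rightarrow> ((nat, 'i) struct \<Rightarrow> bool) \<Rightarrow> (nat, 'i) struct set \<Rightarrow> bool" where
  "is_dual I \<delta> P \<D> \<longleftrightarrow> finite \<D> \<and> (\<forall>D\<in>\<D>. is_structure I \<delta> D) \<and>
    (\<forall>A. is_structure I \<delta> A \<longrightarrow> (P A \<longleftrightarrow> (\<forall>D\<in>\<D>. \<not> hom_to I A D)))"

lemma tree_duality: "\<exists>\<D>. is_dual I \<delta> (\<lambda>A. \<exists>a\<in>base A. sat A a t) \<D>"
proof -
  obtain \<Phi> where \<Phi>: "finite \<Phi>" "closed_branches \<Phi>" "set (branches t) \<subseteq> \<Phi>"
    using finite_closed_branches by blast
  let ?D = "tree_dual I \<delta> \<Phi> t"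
  note dual = hom_to_tree_dual[OF \<Phi>(2,3), where I = I and \<delta> = \<delta>]
  show ?thesis
  proof (cases "base ?D = {}")
    \<comment> \<open>The tree is a bare root and holds everywhere; an empty structure cannot serve as its dual.\<close>
    case True
    have "\<not> hom_to I A ?D" if "is_structure I \<delta> A" for A :: "(nat, 'a) struct"
      using True is_structureD(2)[OF that] unfolding hom_to_def is_hom_def by auto
    then show ?thesis using dual by (intro exI[of _ "{}"]) (auto simp: is_dual_def)
  next
    case False
    have "is_structure I \<delta> ?D"
      using False \<Phi>(1) by (intro is_structureI) (auto simp: tree_dual_def)
    then obtain N :: "(nat, 'a) struct"
      where N: "is_structure I \<delta> N" "hom_to I ?D N" "hom_to I N ?D" by (rule nat_copy)
    have "hom_to I A N \<longleftrightarrow> hom_to I A ?D" for A :: "(nat, 'a) struct"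
      using hom_to_trans[OF _ N(2)] hom_to_trans[OF _ N(3)] by blast
    then show ?thesis using dual N(1) by (intro exI[of _ "{N}"]) (auto simp: is_dual_def)
  qed
qed

text \<open>Up to homomorphic equivalence these are the forests: a finite set of formulas, each required at
  some vertex, describes a disjoint union of rooted trees. The definition is invariant under
  equivalence and exposes exactly what the construction of duals consumes.\<close>
definition forestlike :: "'i set \<Rightarrow> ('i \<Rightarrow> nat) \<Rightarrow> (nat, 'i) struct \<Rightarrow> bool" where
  "forestlike I \<delta> F \<longleftrightarrow> (\<exists>Ts. finite Ts \<and>
    (\<forall>B :: (nat, 'i) struct. is_structure I \<delta> B \<longrightarrow> (hom_to I F B \<longleftrightarrow> models B Ts)))"

lemma forest_duality:
  assumes "forestlike I \<delta> F"
  shows "\<exists>\<D>. is_dual I \<delta> (hom_to I F) \<D>"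
proof -
  obtain Ts where Ts: "finite Ts"
      "\<And>B :: (nat, 'a) struct. is_structure I \<delta> B \<Longrightarrow> hom_to I F B \<longleftrightarrow> models B Ts"
    using assms unfolding forestlike_def by blast
  have "\<forall>t. \<exists>\<D>. is_dual I \<delta> (\<lambda>A. \<exists>a\<in>base A. sat A a t) \<D>" by (intro allI tree_duality)
  from choice[OF this] obtain \<D> where \<D>:
    "\<And>t. is_dual I \<delta> (\<lambda>A. \<exists>a\<in>base A. sat A a t) (\<D> t)" by blast
  have "is_dual I \<delta> (hom_to I F) (\<Union>t\<in>Ts. \<D> t)"
    unfolding is_dual_def
  proof (intro conjI allI impI)
    show "finite (\<Union>t\<in>Ts. \<D> t)" "\<forall>D\<in>\<Union>t\<in>Ts. \<D> t. is_structure I \<delta> D"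
      using \<D> Ts(1) unfolding is_dual_def by auto
    fix A :: "(nat, 'a) struct" assume A: "is_structure I \<delta> A"
    have "(\<exists>a\<in>base A. sat A a t) \<longleftrightarrow> (\<forall>D\<in>\<D> t. \<not> hom_to I A D)" for t
      using \<D> A unfolding is_dual_def by blast
    then show "hom_to I F A \<longleftrightarrow> (\<forall>D\<in>\<Union>t\<in>Ts. \<D> t. \<not> hom_to I A D)"
      using Ts(2)[OF A] by (simp add: models_def)
  qed
  then show ?thesis by blast
qed

text \<open>Avoiding several forests at once means mapping to a product of one dual for each of them.\<close>
lemma forest_set_duality:
  assumes fin: "finite \<F>" and forest: "\<And>F. F \<in> \<F> \<Longrightarrow> forestlike I \<delta> F"
  shows "\<exists>\<D>. is_dual I \<delta> (\<lambda>A. \<exists>F\<in>\<F>. hom_to I F A) \<D>"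
  using fin forest
proof (induction \<F>)
  case empty
  define D :: "(nat, 'a) struct" where
    "D = Struct {0} (\<lambda>i. if i \<in> I then {replicate (\<delta> i) 0} else {})"
  have D: "is_structure I \<delta> D" by (rule is_structureI) (auto simp: D_def split: if_splits)
  have "is_hom I (\<lambda>_. 0) A D" if A: "is_structure I \<delta> A" for A :: "(nat, 'a) struct"
    using is_structureD(4)[OF A] by (intro is_homI) (simp_all add: D_def map_replicate_const)
  then have "is_dual I \<delta> (\<lambda>A. \<exists>F\<in>{}. hom_to I F A) {D}"
    using D unfolding is_dual_def hom_to_def by auto
  then show ?case by blast
next
  case (insert F \<F>)
  obtain \<D> where \<D>: "is_dual I \<delta> (\<lambda>A. \<exists>F\<in>\<F>. hom_to I F A) \<D>"
    using insert.IH insert.prems by blast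
  obtain \<E> where \<E>: "is_dual I \<delta> (hom_to I F) \<E>"
    using forest_duality insert.prems by blast
  have "\<forall>p\<in>\<D> \<times> \<E>. \<exists>N :: (nat, 'a) struct. is_structure I \<delta> N \<and>
      (\<forall>A :: (nat, 'a) struct. hom_to I A N \<longleftrightarrow> hom_to I A (fst p) \<and> hom_to I A (snd p))"
  proof
    fix p assume "p \<in> \<D> \<times> \<E>"
    then have "is_structure I \<delta> (fst p)" "is_structure I \<delta> (snd p)"
      using \<D> \<E> unfolding is_dual_def by auto
    from nat_copy[OF product_structure[OF this]] obtain N :: "(nat, 'a) struct" where N:
      "is_structure I \<delta> N" "hom_to I (product (fst p) (snd p)) N" "hom_to I N (product (fst p) (snd p))" .
    have "hom_to I A N \<longleftrightarrow> hom_to I A (product (fst p) (snd p))" for A :: "(nat, 'a) struct"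
      using hom_to_trans[OF _ N(2)] hom_to_trans[OF _ N(3)] by blast
    then show "\<exists>N :: (nat, 'a) struct. is_structure I \<delta> N \<and>
      (\<forall>A :: (nat, 'a) struct. hom_to I A N \<longleftrightarrow> hom_to I A (fst p) \<and> hom_to I A (snd p))"
      using N(1) unfolding hom_to_product by blast
  qed
  from bchoice[OF this] obtain N :: "_ \<Rightarrow> (nat, 'a) struct" where N:
    "\<forall>p\<in>\<D> \<times> \<E>. is_structure I \<delta> (N p) \<and>
      (\<forall>A :: (nat, 'a) struct. hom_to I A (N p) \<longleftrightarrow> hom_to I A (fst p) \<and> hom_to I A (snd p))" ..
  have "is_dual I \<delta> (\<lambda>A. \<exists>F\<in>insert F \<F>. hom_to I F A) (N ` (\<D> \<times> \<E>))"
    unfolding is_dual_def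
  proof (intro conjI allI impI)
    show "finite (N ` (\<D> \<times> \<E>))" using \<D> \<E> unfolding is_dual_def by blast
    show "\<forall>D\<in>N ` (\<D> \<times> \<E>). is_structure I \<delta> D" using N by auto
    fix A :: "(nat, 'a) struct" assume A: "is_structure I \<delta> A"
    have "(\<exists>F\<in>\<F>. hom_to I F A) \<longleftrightarrow> (\<forall>D\<in>\<D>. \<not> hom_to I A D)"
      "hom_to I F A \<longleftrightarrow> (\<forall>D\<in>\<E>. \<not> hom_to I A D)"
      using \<D> \<E> A unfolding is_dual_def by auto
    moreover have "(\<forall>D\<in>N ` (\<D> \<times> \<E>). \<not> hom_to I A D) \<longleftrightarrow>
        (\<forall>D\<in>\<D>. \<forall>E\<in>\<E>. \<not> (hom_to I A D \<and> hom_to I A E))"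
      using N by simp
    ultimately show "(\<exists>F\<in>insert F \<F>. hom_to I F A) \<longleftrightarrow> (\<forall>D\<in>N ` (\<D> \<times> \<E>). \<not> hom_to I A D)"
      by blast
  qed
  then show ?case by blast
qed

section \<open>Sparse sets of tuples\<close>

abbreviation verts :: "('i \<times> 'a list) set \<Rightarrow> 'a set" where
  "verts E \<equiv> (\<Union>e\<in>E. set (snd e))"

definition tups :: "('a, 'i) struct \<Rightarrow> ('i \<times> 'a list) set" where
  "tups A = {(i, xs). xs \<in> rels A i}"

definition leaf :: "('i \<times> 'a list) set \<Rightarrow> 'i \<times> 'a list \<Rightarrow> 'a \<Rightarrow> bool" where
  "leaf E e y \<longleftrightarrow> e \<in> E \<and> distinct (snd e) \<and> set (snd e) \<inter> verts (E - {e}) \<subseteq> {y}"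

text \<open>This is girth greater than \<open>n\<close>, phrased so that few tuples can be removed one leaf at a time.\<close>
definition sparse :: "nat \<Rightarrow> ('i \<times> 'a list) set \<Rightarrow> bool" where
  "sparse n T \<longleftrightarrow> (\<forall>E\<subseteq>T. E \<noteq> {} \<longrightarrow> finite E \<longrightarrow> card E \<le> n \<longrightarrow> (\<exists>e y. leaf E e y))"

lemma sparseD: "sparse n T \<Longrightarrow> E \<subseteq> T \<Longrightarrow> E \<noteq> {} \<Longrightarrow> finite E \<Longrightarrow> card E \<le> n \<Longrightarrow> \<exists>e y. leaf E e y"
  unfolding sparse_def by blast

lemma sparse_mono: "sparse n T \<Longrightarrow> T' \<subseteq> T \<Longrightarrow> m \<le> n \<Longrightarrow> sparse m T'"
  unfolding sparse_def by (meson order_trans)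

lemma finite_tups:
  assumes A: "is_structure I \<delta> A" and I: "finite I"
  shows "finite (tups A)"
proof (rule finite_subset)
  show "tups A \<subseteq> (SIGMA i:I. {xs. set xs \<subseteq> base A \<and> length xs = \<delta> i})"
    using is_structureD[OF A] unfolding tups_def by blast
  show "finite (SIGMA i:I. {xs. set xs \<subseteq> base A \<and> length xs = \<delta> i})"
    using I is_structureD(1)[OF A] by (intro finite_SigmaI finite_lists_length_eq)
qed

text \<open>A prescribed vertex \<open>y\<close> may be counted as occupied. If a leaf contains \<open>y\<close> besides its attaching
  vertex \<open>z\<close>, then removing it and prescribing \<open>z\<close> for the rest yields a leaf away from \<open>y\<close>.\<close>
lemma sparse_leaf_avoiding:
  assumes "sparse n T" "E \<subseteq> T" "E \<noteq> {}" "finite E" "card E \<le> n"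
  shows "\<exists>e\<in>E. \<exists>z. distinct (snd e) \<and> set (snd e) \<inter> insert y (verts (E - {e})) \<subseteq> {z}"
  using assms(2-)
proof (induction "card E" arbitrary: E y)
  case 0
  then show ?case by simp
next
  case (Suc m)
  obtain e z where e: "leaf E e z" using sparseD[OF assms(1) Suc.prems] by blast
  show ?case
  proof (cases "y \<in> set (snd e) \<and> verts (E - {e}) \<inter> set (snd e) \<noteq> {} \<and> y \<noteq> z")
    case False
    consider "y \<notin> set (snd e) \<or> y = z" | "y \<in> set (snd e)" "verts (E - {e}) \<inter> set (snd e) = {}"
      using False by blast
    then show ?thesis
    proof cases
      case 1
      then show ?thesis using e unfolding leaf_def by (intro bexI[of _ e] exI[of _ z]) auto
    next
      case 2
      then show ?thesis using e unfolding leaf_def by (intro bexI[of _ e] exI[of _ y]) auto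
    qed
  next
    case True
    then have ne: "E - {e} \<noteq> {}" by auto
    have "e \<in> E" using e unfolding leaf_def by blast
    have "\<exists>e'\<in>E - {e}. \<exists>z'. distinct (snd e') \<and>
        set (snd e') \<inter> insert z (verts (E - {e} - {e'})) \<subseteq> {z'}"
      using Suc.prems Suc.hyps(2) ne \<open>e \<in> E\<close> by (intro Suc.hyps(1)) auto
    then obtain e' z' where e': "e' \<in> E - {e}" "distinct (snd e')"
        "set (snd e') \<inter> insert z (verts (E - {e} - {e'})) \<subseteq> {z'}" by blast
    have "set (snd e) \<inter> set (snd e') \<subseteq> {z}" using e e'(1) unfolding leaf_def by blast
    moreover have "y \<notin> set (snd e')" using calculation True by blast
    moreover have "verts (E - {e'}) \<subseteq> set (snd e) \<union> verts (E - {e} - {e'})" by blast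
    ultimately have "set (snd e') \<inter> insert y (verts (E - {e'})) \<subseteq> {z'}" using e'(3) by blast
    then show ?thesis using e'(1,2) by blast
  qed
qed

definition map_tup :: "('a \<Rightarrow> 'b) \<Rightarrow> 'i \<times> 'a list \<Rightarrow> 'i \<times> 'b list" where
  "map_tup f e = (fst e, map f (snd e))"

lemma map_tup_simps [simp]:
  "fst (map_tup f e) = fst e" "snd (map_tup f e) = map f (snd e)" "map_tup f (i, xs) = (i, map f xs)"
  by (simp_all add: map_tup_def)

lemma verts_image: "verts (map_tup f ` E) = f ` verts E"
  by auto

lemma inj_on_map_tup: "inj_on f (verts T) \<Longrightarrow> inj_on (map_tup f) T"
  unfolding inj_on_def
proof (intro ballI impI)
  assume f: "\<forall>x\<in>verts T. \<forall>y\<in>verts T. f x = f y \<longrightarrow> x = y"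
  fix e e' assume e: "e \<in> T" "e' \<in> T" and eq: "map_tup f e = map_tup f e'"
  have "inj_on f (set (snd e) \<union> set (snd e'))" using f e unfolding inj_on_def by blast
  moreover have "map f (snd e) = map f (snd e')" "fst e = fst e'"
    using eq by (simp_all add: prod_eq_iff)
  ultimately show "e = e'" using map_inj_on by (metis prod_eqI)
qed

lemma sparse_image:
  assumes T: "sparse n T" and f: "inj_on f (verts T)"
  shows "sparse n (map_tup f ` T)"
  unfolding sparse_def
proof (intro allI impI)
  fix E assume E: "E \<subseteq> map_tup f ` T" "E \<noteq> {}" "finite E" "card E \<le> n"
  define E0 where "E0 = {e \<in> T. map_tup f e \<in> E}"
  have E0: "E = map_tup f ` E0"
  proof
    show "E \<subseteq> map_tup f ` E0"
    proof
      fix e assume "e \<in> E"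
      then obtain u where "u \<in> T" "e = map_tup f u" using E(1) by blast
      then show "e \<in> map_tup f ` E0" using \<open>e \<in> E\<close> by (intro image_eqI[of _ _ u]) (simp_all add: E0_def)
    qed
  qed (simp add: E0_def image_subset_iff)
  have E0T: "E0 \<subseteq> T" by (simp add: E0_def subset_iff)
  have inj: "inj_on (map_tup f) E0" by (rule inj_on_subset[OF inj_on_map_tup[OF f] E0T])
  have "finite E0" "card E0 = card E" "E0 \<noteq> {}"
    using E(2,3) inj by (auto simp: E0 card_image finite_image_iff)
  then obtain e y where e: "leaf E0 e y" using sparseD[OF T E0T] E(4) by auto
  have "e \<in> E0" using e unfolding leaf_def by blast
  have "E - {map_tup f e} = map_tup f ` (E0 - {e})"
    using inj_on_image_set_diff[OF inj, of E0 "{e}"] \<open>e \<in> E0\<close> by (simp add: E0)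
  then have "verts (E - {map_tup f e}) = f ` verts (E0 - {e})" by (simp only: verts_image)
  moreover have "f ` set (snd e) \<inter> f ` verts (E0 - {e}) = f ` (set (snd e) \<inter> verts (E0 - {e}))"
    using E0T \<open>e \<in> E0\<close> by (intro inj_on_image_Int[OF f, symmetric]) blast+
  moreover have "distinct (map f (snd e))"
    using e E0T \<open>e \<in> E0\<close> unfolding leaf_def distinct_map
    by (intro conjI inj_on_subset[OF f]) blast+
  moreover have "map_tup f e \<in> E" using E0 \<open>e \<in> E0\<close> by blast
  ultimately have "leaf E (map_tup f e) (f y)"
    using e image_mono[of "set (snd e) \<inter> verts (E0 - {e})" "{y}" f] unfolding leaf_def by simp
  then show "\<exists>e y. leaf E e y" by blast
qed

lemma sparse_Un:
  assumes "sparse n S" "sparse n T" "verts S \<inter> verts T = {}"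
  shows "sparse n (S \<union> T)"
  unfolding sparse_def
proof (intro allI impI)
  fix E assume E: "E \<subseteq> S \<union> T" "E \<noteq> {}" "finite E" "card E \<le> n"
  have *: "\<exists>e y. leaf E e y"
    if E: "E \<subseteq> S \<union> T" "E \<inter> S \<noteq> {}" "finite E" "card E \<le> n"
      and S: "sparse n S" and d: "verts S \<inter> verts T = {}" for S T
  proof -
    have "card (E \<inter> S) \<le> n" using card_mono[of E "E \<inter> S"] E by simp
    then obtain e y where "leaf (E \<inter> S) e y" using sparseD[OF S, of "E \<inter> S"] E by auto
    moreover have "set (snd e) \<inter> verts (E - {e}) \<subseteq> set (snd e) \<inter> verts (E \<inter> S - {e})"
      if "e \<in> S" using E(1) d that by blast
    ultimately have "leaf E e y" unfolding leaf_def by blast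
    then show ?thesis by blast
  qed
  have "E \<inter> S \<noteq> {} \<or> E \<inter> T \<noteq> {}" using E by blast
  then show "\<exists>e y. leaf E e y"
  proof
    assume "E \<inter> S \<noteq> {}"
    then show ?thesis using *[OF E(1) _ E(3,4) assms(1,3)] by blast
  next
    assume ne: "E \<inter> T \<noteq> {}"
    have "E \<subseteq> T \<union> S" "verts T \<inter> verts S = {}" using E(1) assms(3) by blast+
    then show ?thesis using *[OF _ ne E(3,4) assms(2)] by blast
  qed
qed

lemma sparse_insert:
  assumes T: "sparse n T" and d: "distinct xs" and y: "set xs \<inter> verts T \<subseteq> {y}"
  shows "sparse n (insert (i, xs) T)"
  unfolding sparse_def
proof (intro allI impI)
  fix E assume E: "E \<subseteq> insert (i, xs) T" "E \<noteq> {}" "finite E" "card E \<le> n"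
  show "\<exists>e y. leaf E e y"
  proof (cases "(i, xs) \<in> E")
    case True
    have "verts (E - {(i, xs)}) \<subseteq> verts T" using E(1) by blast
    then have "leaf E (i, xs) y" using True d y unfolding leaf_def by auto
    then show ?thesis by blast
  next
    case False
    then show ?thesis using sparseD[OF T] E by blast
  qed
qed

lemma sparse_empty: "sparse n {}"
  by (simp add: sparse_def)

text \<open>Peeling off leaves turns an acyclic set of tuples into tree formulas: a leaf becomes a branch
  demanded at its attaching vertex. The labels \<open>L\<close> accumulate the branches demanded so far.\<close>
lemma acyclic_tree_formula:
  fixes X :: "('a, 'i) struct" and L :: "'a \<Rightarrow> ('i \<times> nat \<times> 'i rtree list) list"
  assumes "finite E" "finite V" "verts E \<subseteq> V" "sparse (card E) E" "\<And>e. e \<in> E \<Longrightarrow> snd e \<noteq> []"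
    and "E \<subseteq> tups X" and "\<And>v. v \<in> V \<Longrightarrow> sat X v (Node (L v))"
  shows "\<exists>Ts. finite Ts \<and> (\<forall>t\<in>Ts. \<exists>v\<in>V. sat X v t) \<and>
    (\<forall>B :: ('b, 'i) struct. (\<forall>i. \<forall>xs\<in>rels B i. set xs \<subseteq> base B) \<longrightarrow> models B Ts \<longrightarrow>
      (\<exists>g. (\<forall>v\<in>V. g v \<in> base B \<and> sat B (g v) (Node (L v))) \<and> map_tup g ` E \<subseteq> tups B))"
  using assms
proof (induction "card E" arbitrary: E V L)
  case 0
  then have "E = {}" by simp
  show ?case
  proof (intro exI[of _ "(\<lambda>v. Node (L v)) ` V"] conjI allI impI)
    show "finite ((\<lambda>v. Node (L v)) ` V)" using 0 by simp
    show "\<forall>t\<in>(\<lambda>v. Node (L v)) ` V. \<exists>v\<in>V. sat X v t" using 0 by blast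
    fix B :: "('b, 'i) struct" assume "models B ((\<lambda>v. Node (L v)) ` V)"
    then have "\<forall>v\<in>V. \<exists>b. b \<in> base B \<and> sat B b (Node (L v))" unfolding models_def by blast
    from bchoice[OF this] show "\<exists>g. (\<forall>v\<in>V. g v \<in> base B \<and> sat B (g v) (Node (L v))) \<and>
        map_tup g ` E \<subseteq> tups B" using \<open>E = {}\<close> by auto
  qed
next
  case (Suc m)
  have "E \<noteq> {}" using Suc.hyps(2) by auto
  then obtain e y where leaf: "leaf E e y" using sparseD[OF Suc.prems(4) order_refl] Suc.prems(1) by auto
  then have eE: "e \<in> E" unfolding leaf_def by blast
  obtain i xs where e: "e = (i, xs)" by (cases e)
  have xs: "distinct xs" "set xs \<inter> verts (E - {e}) \<subseteq> {y}" "xs \<noteq> []" "xs \<in> rels X i" "set xs \<subseteq> V"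
  proof -
    show "distinct xs" "set xs \<inter> verts (E - {e}) \<subseteq> {y}" using leaf unfolding leaf_def by (auto simp: e)
    show "xs \<noteq> []" using Suc.prems(5)[OF eE] by (simp add: e)
    show "xs \<in> rels X i" using Suc.prems(6) eE by (auto simp: e tups_def)
    show "set xs \<subseteq> V" using Suc.prems(3) eE by (force simp: e)
  qed
  obtain j where j: "j < length xs" "set xs \<inter> verts (E - {e}) \<subseteq> {xs ! j}"
  proof (cases "y \<in> set xs")
    case True
    then show ?thesis using that xs(2) by (metis in_set_conv_nth)
  next
    case False
    then show ?thesis using that[of 0] xs(2,3) by fastforce
  qed
  define a where "a = xs ! j"
  have a: "a \<in> set xs" using j(1) by (simp add: a_def)
  define ts where "ts = map (\<lambda>v. if v = a then Node [] else Node (L v)) xs"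
  define E' where "E' = E - {e}"
  define V' where "V' = V - (set xs - {a})"
  define L' where "L' = L(a := (i, j, ts) # L a)"
  have sat_L': "sat X v (Node (L' v))" if v: "v \<in> V'" for v
  proof (cases "v = a")
    case True
    have "sat X v (if v = a then Node [] else Node (L v))" if "v \<in> set xs" for v
      using Suc.prems(7)[of v] xs(5) that by (auto simp: sat_Node[of _ _ "[]"])
    then have "list_all2 (sat X) xs ts"
      unfolding ts_def list_all2_map2 by (simp add: list_all2_same)
    then have "sat X a (Node [(i, j, ts)])"
      using xs(4) j(1) a_def by (auto simp: sat_Node)
    moreover have "sat X a (Node (L a))" using Suc.prems(7) a xs(5) by blast
    ultimately have "sat X a (Node ((i, j, ts) # L a))"
      by (simp add: sat_Node)
    then show ?thesis using True by (simp add: L'_def)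
  next
    case False
    then show ?thesis using v Suc.prems(7) by (simp add: L'_def V'_def)
  qed
  have cardE': "card E' = m" using Suc.hyps(2) eE Suc.prems(1) by (simp add: E'_def)
  have vE': "verts E' \<subseteq> V'" using Suc.prems(3) j(2) unfolding E'_def V'_def a_def by blast
  have "\<exists>Ts. finite Ts \<and> (\<forall>t\<in>Ts. \<exists>v\<in>V'. sat X v t) \<and>
    (\<forall>B :: ('b, 'i) struct. (\<forall>i. \<forall>xs\<in>rels B i. set xs \<subseteq> base B) \<longrightarrow> models B Ts \<longrightarrow>
      (\<exists>g. (\<forall>v\<in>V'. g v \<in> base B \<and> sat B (g v) (Node (L' v))) \<and> map_tup g ` E' \<subseteq> tups B))"
  proof (rule Suc.hyps(1)[OF cardE'[symmetric] _ _ vE' _ _ _ sat_L'])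
    show "finite E'" "finite V'" "E' \<subseteq> tups X" "\<And>e. e \<in> E' \<Longrightarrow> snd e \<noteq> []"
      using Suc.prems by (auto simp: E'_def V'_def)
    show "sparse (card E') E'"
      using sparse_mono[OF Suc.prems(4), of E' "card E'"] card_mono[of E E'] Suc.prems(1)
      by (auto simp: E'_def)
  qed
  then obtain Ts where Ts: "finite Ts" "\<forall>t\<in>Ts. \<exists>v\<in>V'. sat X v t"
    "\<And>B :: ('b, 'i) struct. (\<forall>i. \<forall>xs\<in>rels B i. set xs \<subseteq> base B) \<Longrightarrow> models B Ts \<Longrightarrow>
      (\<exists>g. (\<forall>v\<in>V'. g v \<in> base B \<and> sat B (g v) (Node (L' v))) \<and> map_tup g ` E' \<subseteq> tups B)"
    by blast
  show ?case
  proof (intro exI[of _ Ts] conjI allI impI)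
    show "finite Ts" by (rule Ts)
    show "\<forall>t\<in>Ts. \<exists>v\<in>V. sat X v t" using Ts(2) unfolding V'_def by blast
    fix B :: "('b, 'i) struct"
    assume B: "\<forall>i. \<forall>xs\<in>rels B i. set xs \<subseteq> base B" "models B Ts"
    obtain g where g: "\<forall>v\<in>V'. g v \<in> base B \<and> sat B (g v) (Node (L' v))" "map_tup g ` E' \<subseteq> tups B"
      using Ts(3)[OF B] by blast
    have aV': "a \<in> V'" using a xs(5) by (auto simp: V'_def)
    have "sat B (g a) (Node ((i, j, ts) # L a))" using g(1) aV' by (auto simp: L'_def)
    then have sat_a: "sat B (g a) (Node (L a))" by (auto simp: sat_Node)
    obtain zs where zs: "zs \<in> rels B i" "j < length zs" "zs ! j = g a" "list_all2 (sat B) zs ts"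
      by (rule sat_branch[OF \<open>sat B (g a) (Node ((i, j, ts) # L a))\<close>]) auto
    have len: "length zs = length xs" using list_all2_lengthD[OF zs(4)] by (simp add: ts_def)
    define h where "h v = (if v \<in> set xs then the (map_of (zip xs zs) v) else g v)" for v
    have h_nth: "h (xs ! k) = zs ! k" if "k < length xs" for k
      using map_of_zip_nth[OF _ xs(1), of zs k] len that by (simp add: h_def)
    have h_xs: "map h xs = zs" using h_nth len by (intro nth_equalityI) auto
    have h_other: "h v = g v" if "v \<in> V'" for v
      using that h_nth[OF j(1)] zs(3) by (auto simp: V'_def a_def h_def)
    have "h v \<in> base B \<and> sat B (h v) (Node (L v))" if v: "v \<in> V" for v
    proof (cases "v \<in> V'")
      case True
      then show ?thesis using g(1) h_other[OF True] sat_a by (cases "v = a") (auto simp: L'_def)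
    next
      case False
      then obtain k where k: "k < length xs" "v = xs ! k" "v \<noteq> a"
        using v unfolding V'_def by (auto simp: in_set_conv_nth)
      have "zs ! k \<in> base B" using B(1) zs(1) k(1) len by (metis nth_mem subsetD)
      moreover have "sat B (zs ! k) (ts ! k)" using list_all2_nthD[OF zs(4)] k(1) len by simp
      ultimately show ?thesis using k h_nth[OF k(1)] by (simp add: ts_def)
    qed
    moreover have "map_tup h ` E \<subseteq> tups B"
    proof
      fix u assume "u \<in> map_tup h ` E"
      then obtain f where f: "f \<in> E" "u = map_tup h f" by blast
      show "u \<in> tups B"
      proof (cases "f = e")
        case True
        then show ?thesis using f(2) zs(1) h_xs by (simp add: e tups_def)
      next
        case False
        then have "f \<in> E'" using f(1) by (simp add: E'_def)
        then have "map h (snd f) = map g (snd f)" using vE' h_other by (intro map_cong) auto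
        then have "u = map_tup g f" using f(2) by (cases f) simp
        then show ?thesis using g(2) \<open>f \<in> E'\<close> by blast
      qed
    qed
    ultimately show "\<exists>g. (\<forall>v\<in>V. g v \<in> base B \<and> sat B (g v) (Node (L v))) \<and> map_tup g ` E \<subseteq> tups B"
      by blast
  qed
qed

text \<open>The image of few tuples in a sparse structure is acyclic, so the homomorphism factors through a
  forest; \<open>Ts\<close> describes this forest.\<close>
lemma sparse_factor:
  fixes q :: "('c, 'i) struct" and X :: "('a, 'i) struct"
  assumes q: "is_structure I \<delta> q" and X: "is_structure I \<delta> X" and I: "finite I"
    and pos: "\<And>i. i \<in> I \<Longrightarrow> \<delta> i \<ge> 2"
    and qX: "hom_to I q X" and n: "sparse n (tups X)" "card (tups q) \<le> n"
  shows "\<exists>Ts. finite Ts \<and> models X Ts \<and>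
    (\<forall>B :: ('b, 'i) struct. (\<forall>i. \<forall>xs\<in>rels B i. set xs \<subseteq> base B) \<longrightarrow> models B Ts \<longrightarrow> hom_to I q B)"
proof -
  obtain f where f: "is_hom I f q X" using qX unfolding hom_to_def by blast
  define E where "E = map_tup f ` tups q"
  have fin: "finite (tups q)" by (rule finite_tups[OF q I])
  have EX: "E \<subseteq> tups X"
    unfolding E_def tups_def using is_hom_rels[OF f] is_structureD(3)[OF q] by auto
  have "card E \<le> n" using card_image_le[OF fin, of "map_tup f"] n(2) by (simp add: E_def)
  then have sp: "sparse (card E) E" by (rule sparse_mono[OF n(1) EX])
  have "verts E \<subseteq> f ` base q"
    using is_structureD(5)[OF q] unfolding E_def tups_def by fastforce
  moreover have "snd e \<noteq> []" if "e \<in> E" for e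
    using that pos is_structureD(3,4)[OF q] unfolding E_def tups_def by fastforce
  moreover have "finite E" "finite (f ` base q)"
    using fin is_structureD(1)[OF q] by (simp_all add: E_def)
  ultimately have "\<exists>Ts. finite Ts \<and> (\<forall>t\<in>Ts. \<exists>v\<in>f ` base q. sat X v t) \<and>
    (\<forall>B :: ('b, 'i) struct. (\<forall>i. \<forall>xs\<in>rels B i. set xs \<subseteq> base B) \<longrightarrow> models B Ts \<longrightarrow>
      (\<exists>g. (\<forall>v\<in>f ` base q. g v \<in> base B \<and> sat B (g v) (Node [])) \<and> map_tup g ` E \<subseteq> tups B))"
    using EX sp by (intro acyclic_tree_formula[where L = "\<lambda>_. []"]) (simp_all add: sat_Node)
  then obtain Ts where Ts: "finite Ts" "\<forall>t\<in>Ts. \<exists>v\<in>f ` base q. sat X v t"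
    and g: "\<And>B :: ('b, 'i) struct. (\<forall>i. \<forall>xs\<in>rels B i. set xs \<subseteq> base B) \<Longrightarrow> models B Ts \<Longrightarrow>
      \<exists>g. (\<forall>v\<in>f ` base q. g v \<in> base B \<and> sat B (g v) (Node [])) \<and> map_tup g ` E \<subseteq> tups B"
    by blast
  have "models X Ts" using Ts(2) is_hom_base[OF f] unfolding models_def by blast
  moreover have "hom_to I q B"
    if B: "\<forall>i. \<forall>xs\<in>rels B i. set xs \<subseteq> base B" "models B Ts" for B :: "('b, 'i) struct"
  proof -
    obtain g where g: "\<forall>v\<in>f ` base q. g v \<in> base B" "map_tup g ` E \<subseteq> tups B" using g[OF B] by blast
    have "is_hom I (g \<circ> f) q B"
    proof (rule is_homI)
      show "(g \<circ> f) v \<in> base B" if "v \<in> base q" for v using g(1) that by simp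
      show "map (g \<circ> f) xs \<in> rels B i" if "xs \<in> rels q i" for i xs
      proof -
        have "(i, xs) \<in> tups q" using that by (simp add: tups_def)
        then have "map_tup f (i, xs) \<in> E" unfolding E_def by (rule imageI)
        then have "map_tup g (map_tup f (i, xs)) \<in> tups B" by (rule subsetD[OF g(2) imageI])
        then show ?thesis by (simp add: tups_def)
      qed
    qed
    then show ?thesis unfolding hom_to_def by blast
  qed
  ultimately show ?thesis using Ts(1) by blast
qed

lemma forestlike_if_sparse:
  fixes q :: "(nat, 'i) struct" and X :: "('a, 'i) struct"
  assumes "is_structure I \<delta> q" "is_structure I \<delta> X" "finite I" "\<And>i. i \<in> I \<Longrightarrow> \<delta> i \<ge> 2"
    and "hom_to I q X" "hom_to I X q" "sparse n (tups X)" "card (tups q) \<le> n"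
  shows "forestlike I \<delta> q"
proof -
  obtain Ts where Ts: "finite Ts" "models X Ts"
    "\<And>B :: (nat, 'i) struct. (\<forall>i. \<forall>xs\<in>rels B i. set xs \<subseteq> base B) \<Longrightarrow> models B Ts \<Longrightarrow> hom_to I q B"
    using sparse_factor[OF assms(1-5,7,8)] by blast
  have "models q Ts" by (rule models_hom[OF assms(6,2) Ts(2)])
  have "hom_to I q B \<longleftrightarrow> models B Ts" if B: "is_structure I \<delta> B" for B :: "(nat, 'i) struct"
    using models_hom[OF _ assms(1) \<open>models q Ts\<close>] Ts(3)[of B] is_structureD(5)[OF B] by blast
  then show ?thesis using Ts(1) unfolding forestlike_def by blast
qed

section \<open>Potentials on sparse structures\<close>

definition progression :: "('i \<Rightarrow> nat) \<Rightarrow> ('i \<Rightarrow> int) \<Rightarrow> 'i \<Rightarrow> int \<Rightarrow> int list" where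
  "progression \<delta> st i x = map (\<lambda>p. x + st i * int p) [0..<\<delta> i]"

text \<open>A potential is a homomorphism to the infinite structure on the integers whose tuples of relation
  \<open>i\<close> are all progressions of step \<open>st i\<close>.\<close>
definition has_potential :: "'i set \<Rightarrow> ('i \<Rightarrow> nat) \<Rightarrow> ('i \<Rightarrow> int) \<Rightarrow> ('a, 'i) struct \<Rightarrow> bool" where
  "has_potential I \<delta> st A \<longleftrightarrow>
    (\<exists>h. \<forall>i\<in>I. \<forall>xs\<in>rels A i. \<exists>x. map h xs = progression \<delta> st i x)"

lemma has_potential_hom:
  assumes "hom_to I A B" "has_potential I \<delta> st B"
  shows "has_potential I \<delta> st A"
proof -
  obtain f h where f: "is_hom I f A B"
    and h: "\<forall>i\<in>I. \<forall>xs\<in>rels B i. \<exists>x. map h xs = progression \<delta> st i x"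
    using assms unfolding hom_to_def has_potential_def by blast
  have "\<forall>i\<in>I. \<forall>xs\<in>rels A i. \<exists>x. map (h \<circ> f) xs = progression \<delta> st i x"
    using is_hom_rels[OF f] h by (metis map_map)
  then show ?thesis unfolding has_potential_def by blast
qed

text \<open>In the structure of all progressions every vertex occurs in every position of every
  relation, so a tree formula that holds anywhere at all holds everywhere in it, and whatever maps to a
  forest maps there.\<close>
lemma potential_if_sparse:
  fixes q :: "('c, 'i) struct" and X :: "('a, 'i) struct"
  assumes "is_structure I \<delta> q" and X: "is_structure I \<delta> X"
    and "finite I" "\<And>i. i \<in> I \<Longrightarrow> \<delta> i \<ge> 2"
    and "hom_to I q X" "sparse n (tups X)" "card (tups q) \<le> n"
  shows "has_potential I \<delta> st q"
proof -
  define B :: "(int, 'i) struct" where "B = Struct UNIV (\<lambda>i. range (progression \<delta> st i))"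
  have sat: "sat B b t" if "sat X x t" for b x t
    using that
  proof (induction t arbitrary: b x rule: rtree_induct)
    case (Node bs)
    show ?case
    proof (rule sat.intros)
      fix i j ts assume br: "(i, j, ts) \<in> set bs"
      obtain xs where xs: "xs \<in> rels X i" "j < length xs" "list_all2 (sat X) xs ts"
        using sat_branch[OF Node.prems br] .
      define ys where "ys = progression \<delta> st i (b - st i * int j)"
      have len: "length xs = \<delta> i" "length ys = \<delta> i"
        using is_structureD(4)[OF X xs(1)] by (simp_all add: ys_def progression_def)
      have "ys ! j = b" using xs(2) len by (simp add: ys_def progression_def)
      moreover have "list_all2 (sat B) ys ts"
        unfolding list_all2_conv_all_nth
      proof (intro conjI allI impI)
        show "length ys = length ts" using xs(3) len by (simp add: list_all2_lengthD)
        fix k assume "k < length ys"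
        then have "sat X (xs ! k) (ts ! k)" "ts ! k \<in> set ts"
          using xs(3) len by (simp_all add: list_all2_conv_all_nth)
        then show "sat B (ys ! k) (ts ! k)" using Node.IH[OF br] by blast
      qed
      ultimately show "\<exists>xs\<in>rels B i. j < length xs \<and> xs ! j = b \<and> list_all2 (sat B) xs ts"
        using xs(2) len by (intro bexI[of _ ys]) (simp_all add: B_def ys_def)
    qed
  qed
  obtain Ts where Ts: "models X Ts"
    "\<And>B :: (int, 'i) struct. (\<forall>i. \<forall>xs\<in>rels B i. set xs \<subseteq> base B) \<Longrightarrow> models B Ts \<Longrightarrow> hom_to I q B"
    using sparse_factor[OF assms] by blast
  have "models B Ts" using Ts(1) sat unfolding models_def B_def by auto
  then have "hom_to I q B" by (intro Ts(2)) (simp_all add: B_def)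
  moreover have "has_potential I \<delta> st B"
    unfolding has_potential_def by (rule exI[of _ id]) (auto simp: B_def)
  ultimately show ?thesis by (rule has_potential_hom)
qed

section \<open>The sparse incomparability lemma\<close>

text \<open>The fibres of \<open>\<pi>\<close> are the parts of \<open>T\<close>. Every colouring of \<open>T\<close> has to admit lifts of all
  tuples of \<open>D\<close>, which need not fit together to a copy of \<open>D\<close>, on which the parts over \<open>S\<close> are
  monochromatic.\<close>
definition arrows :: "nat \<Rightarrow> 'd set \<Rightarrow> ('i \<times> 'd list) set \<Rightarrow> ('i \<times> nat list) set \<Rightarrow> (nat \<Rightarrow> 'd) \<Rightarrow> bool"
  where "arrows k S D T \<pi> \<longleftrightarrow> (\<forall>\<chi>. (\<forall>v. \<chi> v < k) \<longrightarrow> (\<exists>\<phi>. (\<forall>d. \<phi> d < k) \<and>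
    (\<forall>e\<in>D. \<exists>u\<in>T. map_tup \<pi> u = e \<and> (\<forall>y\<in>set (snd u). \<pi> y \<in> S \<longrightarrow> \<chi> y = \<phi> (\<pi> y)))))"

definition sparse_system :: "nat \<Rightarrow> nat \<Rightarrow> 'd set \<Rightarrow> ('i \<times> 'd list) set \<Rightarrow> ('i \<times> nat list) set \<Rightarrow>
    (nat \<Rightarrow> 'd) \<Rightarrow> bool" where
  "sparse_system n k S D T \<pi> \<longleftrightarrow>
    finite T \<and> sparse n T \<and> map_tup \<pi> ` T \<subseteq> D \<and> arrows k S D T \<pi>"

definition ramsey_hypergraph :: "nat \<Rightarrow> nat \<Rightarrow> nat \<Rightarrow> nat list set \<Rightarrow> bool" where
  "ramsey_hypergraph n r k H \<longleftrightarrow> finite H \<and> (\<forall>ys\<in>H. length ys = r \<and> distinct ys) \<and>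
    sparse n (Pair () ` H) \<and>
    (\<forall>\<chi> :: nat \<Rightarrow> nat. (\<forall>v. \<chi> v < k) \<longrightarrow> (\<exists>ys\<in>H. \<forall>y\<in>set ys. \<chi> y = \<chi> (hd ys)))"

text \<open>One step of the partite construction of Nesetril and Roedl: every edge of a Ramsey hypergraph
  receives its own copy of \<open>T\<close>, whose vertices over \<open>d\<close> are placed on that edge. In an edge of one
  colour the copy is monochromatic over \<open>d\<close>. Copies meet in vertices over \<open>d\<close> only, and a tuple
  has at most one such vertex, so a cycle through several copies uses two tuples of each of them.
  This is why hypergraphs of half the girth suffice.\<close>
lemma amalgamate:
  fixes T :: "('i \<times> nat list) set" and D :: "('i \<times> 'd list) set"
  assumes sys: "sparse_system n k S D T \<pi>"
    and D: "\<And>e. e \<in> D \<Longrightarrow> distinct (snd e) \<and> 2 \<le> length (snd e)"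
    and hyp: "\<And>r. \<exists>H. ramsey_hypergraph (n div 2) (r + 2) k H"
  shows "\<exists>T' \<pi>'. sparse_system n k (insert d S) D T' \<pi>'"
proof -
  have T: "finite T" "sparse n T" "map_tup \<pi> ` T \<subseteq> D" "arrows k S D T \<pi>"
    using sys unfolding sparse_system_def by blast+
  define V where "V = {v \<in> verts T. \<pi> v = d}"
  have "finite V" using T(1) by (simp add: V_def)
  then obtain idx where idx: "bij_betw idx V {0..<card V}" using ex_bij_betw_finite_nat by blast
  obtain H where H: "ramsey_hypergraph (n div 2) (card V + 2) k H" using hyp by blast
  have H_len: "length ys = card V + 2" "distinct ys" if "ys \<in> H" for ys
    using H that unfolding ramsey_hypergraph_def by blast+
  have idx_less: "idx v < length ys" if "v \<in> V" "ys \<in> H" for v ys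
    using bij_betwE[OF idx] H_len(1)[OF that(2)] that(1) by force
  \<comment> \<open>The codes \<open>(0, w)\<close> are the shared vertices; \<open>(Suc c, v)\<close> is \<open>v\<close> in the copy with code \<open>c\<close>.\<close>
  define enc where "enc ys v = prod_encode (if \<pi> v = d then (0, ys ! idx v) else (Suc (list_encode ys), v))"
    for ys v
  define \<pi>' where "\<pi>' w = (if fst (prod_decode w) = 0 then d else \<pi> (snd (prod_decode w)))" for w
  define C where "C ys = map_tup (enc ys) ` T" for ys
  define T' where "T' = (\<Union>ys\<in>H. C ys)"
  have \<pi>'_enc: "\<pi>' (enc ys v) = \<pi> v" for ys v by (simp add: \<pi>'_def enc_def)
  have \<pi>'_0: "\<pi>' (prod_encode (0, w)) = d" for w by (simp add: \<pi>'_def)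
  have map_\<pi>': "map_tup \<pi>' (map_tup (enc ys) u) = map_tup \<pi> u" for ys and u :: "'i \<times> nat list"
    by (simp add: map_tup_def comp_def \<pi>'_enc)
  have enc_inj: "inj_on (enc ys) (verts T)" if ys: "ys \<in> H" for ys
  proof (rule inj_onI)
    fix u v assume u: "u \<in> verts T" and v: "v \<in> verts T" and eq: "enc ys u = enc ys v"
    show "u = v"
    proof (cases "\<pi> u = d")
      case True
      then have "\<pi> v = d" using eq \<pi>'_enc by metis
      then have uv: "u \<in> V" "v \<in> V" using True u v by (simp_all add: V_def)
      have "ys ! idx u = ys ! idx v" using eq True \<open>\<pi> v = d\<close> by (simp add: enc_def)
      then have "idx u = idx v"
        using nth_eq_iff_index_eq[OF H_len(2)[OF ys]] idx_less[OF _ ys] uv by blast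
      then show ?thesis using idx uv by (meson bij_betw_imp_inj_on inj_onD)
    next
      case False
      then have "\<pi> v \<noteq> d" using eq \<pi>'_enc by metis
      then show ?thesis using eq False by (simp add: enc_def)
    qed
  qed
  have common: "\<exists>w. u = prod_encode (0, w) \<and> w \<in> set ys \<and> w \<in> set ys'"
    if cm: "ys \<in> H" "ys' \<in> H" "ys \<noteq> ys'" "u \<in> verts (C ys)" "u \<in> verts (C ys')" for u ys ys'
  proof -
    obtain v v' where v: "v \<in> verts T" "u = enc ys v" "v' \<in> verts T" "u = enc ys' v'"
      using cm(4,5) unfolding C_def verts_image by blast
    have "\<pi> v = d" "\<pi> v' = d"
      using v(2,4) cm(3) by (auto simp: enc_def list_encode_eq split: if_splits)
    then have "v \<in> V" "v' \<in> V" "u = prod_encode (0, ys ! idx v)" "u = prod_encode (0, ys' ! idx v')"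
      using v by (auto simp: V_def enc_def)
    then show ?thesis using idx_less cm(1,2) by (metis nth_mem prod_encode_eq prod.inject)
  qed
  have T'_D: "map_tup \<pi>' ` T' \<subseteq> D"
  proof
    fix e assume "e \<in> map_tup \<pi>' ` T'"
    then obtain ys u where "u \<in> T" "e = map_tup \<pi>' (map_tup (enc ys) u)" unfolding T'_def C_def by blast
    then show "e \<in> D" using T(3) map_\<pi>' by auto
  qed
  have T'_dist: "distinct (map \<pi>' (snd e))" "2 \<le> length (snd e)" if "e \<in> T'" for e
    using D[of "map_tup \<pi>' e"] T'_D that by auto
  have zero_unique: "w = w'"
    if "e \<in> T'" "prod_encode (0, w) \<in> set (snd e)" "prod_encode (0, w') \<in> set (snd e)" for e w w'
    using inj_onD[of \<pi>' "set (snd e)" "prod_encode (0, w)" "prod_encode (0, w')"]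
      T'_dist(1)[OF that(1)] that(2,3) by (simp add: distinct_map \<pi>'_0)
  have C_disj: "ys = ys'" if "ys \<in> H" "ys' \<in> H" "e \<in> C ys" "e \<in> C ys'" for ys ys' e
  proof (rule ccontr)
    assume ne: "ys \<noteq> ys'"
    have eT': "e \<in> T'" using that unfolding T'_def by blast
    have "\<exists>w. u = prod_encode (0, w)" if "u \<in> set (snd e)" for u
      using common[OF \<open>ys \<in> H\<close> \<open>ys' \<in> H\<close> ne, of u] that \<open>e \<in> C ys\<close> \<open>e \<in> C ys'\<close> by blast
    then have "u = v" if "u \<in> set (snd e)" "v \<in> set (snd e)" for u v
      using zero_unique[OF eT'] that by metis
    moreover have len: "0 < length (snd e)" "1 < length (snd e)" using T'_dist(2)[OF eT'] by linarith+
    moreover have "snd e ! 0 \<noteq> snd e ! 1"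
      using T'_dist(1)[OF eT'] nth_eq_iff_index_eq[OF _ len] by (simp add: distinct_map)
    ultimately show False using nth_mem by blast
  qed
  have "sparse n T'"
    unfolding sparse_def
  proof (intro allI impI)
    fix E assume E: "E \<subseteq> T'" "E \<noteq> {}" "finite E" "card E \<le> n"
    define \<E> where "\<E> = {ys \<in> H. E \<inter> C ys \<noteq> {}}"
    have E_Un: "E = (\<Union>ys\<in>\<E>. E \<inter> C ys)" using E(1) unfolding T'_def \<E>_def by blast
    have fin\<E>: "finite \<E>" using H unfolding \<E>_def ramsey_hypergraph_def by simp
    have E_dist: "distinct (snd e)" if "e \<in> E" for e
      using T'_dist(1) E(1) that by (meson distinct_map subsetD)
    have E_other: "u \<in> verts (E \<inter> C ys - {e}) \<or>
        (\<exists>w. u = prod_encode (0, w) \<and> (\<exists>ys'\<in>\<E>. ys' \<noteq> ys \<and> w \<in> set ys \<inter> set ys'))"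
      if e: "e \<in> E" "e \<in> C ys" "ys \<in> H" and u: "u \<in> set (snd e)" "u \<in> verts (E - {e})" for e ys u
    proof -
      obtain f where f: "f \<in> E" "f \<noteq> e" "u \<in> set (snd f)" using u(2) by blast
      obtain ys' where ys': "ys' \<in> \<E>" "f \<in> C ys'" using f(1) E_Un by blast
      show ?thesis
      proof (cases "ys' = ys")
        case True
        then show ?thesis using f ys' by blast
      next
        case False
        have "ys' \<in> H" using ys'(1) by (simp add: \<E>_def)
        then obtain w where "u = prod_encode (0, w)" "w \<in> set ys" "w \<in> set ys'"
          using common[OF e(3) _ False[symmetric], of u] e(2) u(1) f(3) ys'(2) by blast
        then show ?thesis using ys'(1) False by blast
      qed
    qed
    show "\<exists>e y. leaf E e y"
    proof (cases "\<exists>ys\<in>H. card (E \<inter> C ys) = 1")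
      case True
      \<comment> \<open>A lone tuple of a copy meets the other copies in at most one vertex, which lies over \<open>d\<close>.\<close>
      then obtain ys e where ys: "ys \<in> H" "E \<inter> C ys = {e}" by (auto simp: card_1_singleton_iff)
      have e: "e \<in> E" "e \<in> C ys" using ys(2) by blast+
      have zero: "\<exists>w. u = prod_encode (0, w)" if "u \<in> set (snd e)" "u \<in> verts (E - {e})" for u
        using E_other[OF e ys(1) that] ys(2) by auto
      have "\<exists>y. set (snd e) \<inter> verts (E - {e}) \<subseteq> {y}"
      proof (cases "set (snd e) \<inter> verts (E - {e}) = {}")
        case False
        then obtain y where y: "y \<in> set (snd e)" "y \<in> verts (E - {e})" by blast
        have "u = y" if "u \<in> set (snd e)" "u \<in> verts (E - {e})" for u
          using zero[OF that] zero[OF y] zero_unique[of e] that(1) y(1) e(1) E(1) by blast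
        then show ?thesis by blast
      qed blast
      then show ?thesis using e(1) E_dist unfolding leaf_def by blast
    next
      case False
      have "2 \<le> card (E \<inter> C ys)" if "ys \<in> \<E>" for ys
      proof -
        have "card (E \<inter> C ys) \<noteq> 0" "card (E \<inter> C ys) \<noteq> 1"
          using that False E(3) by (auto simp: \<E>_def)
        then show ?thesis by linarith
      qed
      then have "card \<E> * 2 \<le> (\<Sum>ys\<in>\<E>. card (E \<inter> C ys))"
        using sum_bounded_below[of \<E> 2 "\<lambda>ys. card (E \<inter> C ys)"] by simp
      also have "\<dots> = card (\<Union>ys\<in>\<E>. E \<inter> C ys)"
        using C_disj E(3) fin\<E> by (intro card_UN_disjoint[symmetric]) (auto simp: \<E>_def)
      also have "\<dots> \<le> n" using E_Un E(4) by simp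
      finally have card\<E>: "card (Pair () ` \<E>) \<le> n div 2"
        using card_image_le[OF fin\<E>, of "Pair ()"] by linarith
      have "\<E> \<noteq> {}" using E_Un E(2) by blast
      then obtain l y where l: "leaf (Pair () ` \<E>) l y"
        using sparseD[of "n div 2" "Pair () ` H" "Pair () ` \<E>"] H card\<E> fin\<E>
        unfolding ramsey_hypergraph_def \<E>_def by blast
      then obtain ys where ys: "l = ((), ys)" "ys \<in> \<E>" unfolding leaf_def by blast
      have ysH: "ys \<in> H" using ys(2) by (simp add: \<E>_def)
      have y: "w = y" if "w \<in> set ys" "w \<in> set ys'" "ys' \<in> \<E>" "ys' \<noteq> ys" for w ys'
      proof -
        have "((), ys') \<in> Pair () ` \<E> - {l}" using that(3,4) ys(1) by simp
        then have "w \<in> set (snd l) \<inter> verts (Pair () ` \<E> - {l})" using that(1,2) ys(1) by fastforce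
        then show ?thesis using l unfolding leaf_def by blast
      qed
      have "sparse n (C ys)" unfolding C_def by (rule sparse_image[OF T(2) enc_inj[OF ysH]])
      moreover have "card (E \<inter> C ys) \<le> n" using card_mono[OF E(3), of "E \<inter> C ys"] E(4) by simp
      ultimately obtain e z where e: "e \<in> E \<inter> C ys"
        "set (snd e) \<inter> insert (prod_encode (0, y)) (verts (E \<inter> C ys - {e})) \<subseteq> {z}"
        using sparse_leaf_avoiding[of n "C ys" "E \<inter> C ys" "prod_encode (0, y)"] E(3) ys(2)
        unfolding \<E>_def by blast
      have "u = z" if "u \<in> set (snd e)" "u \<in> verts (E - {e})" for u
        using E_other[OF _ _ ysH that] e y that(1) by blast
      then have "leaf E e z" using e(1) E_dist unfolding leaf_def by blast
      then show ?thesis by blast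
    qed
  qed
  moreover have "arrows k (insert d S) D T' \<pi>'"
    unfolding arrows_def
  proof (intro allI impI)
    fix \<chi> :: "nat \<Rightarrow> nat" assume \<chi>: "\<forall>v. \<chi> v < k"
    obtain ys where ys: "ys \<in> H" "\<forall>y\<in>set ys. \<chi> (prod_encode (0, y)) = \<chi> (prod_encode (0, hd ys))"
      using H \<chi> unfolding ramsey_hypergraph_def by meson
    define c where "c = \<chi> (prod_encode (0, hd ys))"
    have "\<exists>\<phi>. (\<forall>d. \<phi> d < k) \<and> (\<forall>e\<in>D. \<exists>u\<in>T. map_tup \<pi> u = e \<and>
        (\<forall>y\<in>set (snd u). \<pi> y \<in> S \<longrightarrow> \<chi> (enc ys y) = \<phi> (\<pi> y)))"
      by (rule mp[OF spec[OF T(4)[unfolded arrows_def], of "\<lambda>v. \<chi> (enc ys v)"]]) (use \<chi> in simp)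
    then obtain \<phi> where \<phi>: "\<forall>d. \<phi> d < k" "\<forall>e\<in>D. \<exists>u\<in>T. map_tup \<pi> u = e \<and>
        (\<forall>y\<in>set (snd u). \<pi> y \<in> S \<longrightarrow> \<chi> (enc ys y) = \<phi> (\<pi> y))" by blast
    show "\<exists>\<phi>. (\<forall>d. \<phi> d < k) \<and> (\<forall>e\<in>D. \<exists>u\<in>T'. map_tup \<pi>' u = e \<and>
        (\<forall>y\<in>set (snd u). \<pi>' y \<in> insert d S \<longrightarrow> \<chi> y = \<phi> (\<pi>' y)))"
    proof (intro exI[of _ "\<phi>(d := c)"] conjI ballI)
      show "\<forall>d'. (\<phi>(d := c)) d' < k" using \<phi>(1) \<chi> by (simp add: c_def)
      fix e assume "e \<in> D"
      then obtain u where u: "u \<in> T" "map_tup \<pi> u = e"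
        "\<forall>y\<in>set (snd u). \<pi> y \<in> S \<longrightarrow> \<chi> (enc ys y) = \<phi> (\<pi> y)" using \<phi>(2) by blast
      have "\<chi> (enc ys v) = (\<phi>(d := c)) (\<pi> v)" if v: "v \<in> set (snd u)" "\<pi> v \<in> insert d S" for v
      proof (cases "\<pi> v = d")
        case True
        then have "v \<in> V" using u(1) v(1) by (auto simp: V_def)
        then have "ys ! idx v \<in> set ys" using idx_less ys(1) by simp
        then show ?thesis using True ys(2) by (simp add: enc_def c_def)
      next
        case False
        then show ?thesis using u(3) v by simp
      qed
      then show "\<exists>u\<in>T'. map_tup \<pi>' u = e \<and>
          (\<forall>y\<in>set (snd u). \<pi>' y \<in> insert d S \<longrightarrow> \<chi> y = (\<phi>(d := c)) (\<pi>' y))"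
        using u(1,2) ys(1) map_\<pi>'
        by (intro bexI[of _ "map_tup (enc ys) u"]) (auto simp: \<pi>'_enc T'_def C_def)
    qed
  qed
  moreover have "finite T'"
    using H T(1) unfolding T'_def C_def ramsey_hypergraph_def by blast
  ultimately show ?thesis using T'_D unfolding sparse_system_def by blast
qed

lemma disjoint_copies:
  fixes D :: "('i \<times> 'd list) set"
  assumes D: "finite D" and k: "0 < k"
  shows "\<exists>T \<pi>. sparse_system n k {} D T \<pi>"
proof -
  obtain c :: "'i \<times> 'd list \<Rightarrow> nat" where c: "inj_on c D"
    using finite_imp_inj_to_nat_seg[OF D] by blast
  define copy where "copy e = (fst e, map (\<lambda>p. prod_encode (c e, p)) [0..<length (snd e)])" for e
  define \<pi> where "\<pi> w = snd (inv_into D c (fst (prod_decode w))) ! snd (prod_decode w)" for w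
  have \<pi>: "map_tup \<pi> (copy e) = e" if "e \<in> D" for e
    using that c by (auto simp: copy_def \<pi>_def map_tup_def prod_eq_iff intro: nth_equalityI)
  have "sparse n (copy ` D)"
    unfolding sparse_def
  proof (intro allI impI)
    fix E assume E: "E \<subseteq> copy ` D" "E \<noteq> {}"
    then obtain e where e: "e \<in> D" "copy e \<in> E" by blast
    have "set (snd (copy e)) \<inter> set (snd u) = {}" if uE: "u \<in> E - {copy e}" for u
    proof -
      obtain e' where e': "e' \<in> D" "u = copy e'" using uE E(1) by blast
      then have "c e \<noteq> c e'" using inj_onD[OF c] e(1) uE by blast
      then show ?thesis by (auto simp: e'(2) copy_def)
    qed
    then have "set (snd (copy e)) \<inter> verts (E - {copy e}) = {}" by blast
    moreover have "distinct (snd (copy e))" by (simp add: copy_def distinct_map inj_on_def)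
    ultimately show "\<exists>u y. leaf E u y" using e(2) unfolding leaf_def by blast
  qed
  moreover have "map_tup \<pi> ` copy ` D \<subseteq> D" using \<pi> by auto
  moreover have "arrows k {} D (copy ` D) \<pi>"
    unfolding arrows_def using k \<pi> by (auto intro!: exI[of _ "\<lambda>_. 0"])
  ultimately have "sparse_system n k {} D (copy ` D) \<pi>"
    using D unfolding sparse_system_def by blast
  then show ?thesis by blast
qed

lemma partite_system:
  fixes D :: "('i \<times> 'd list) set"
  assumes D: "finite D" "\<And>e. e \<in> D \<Longrightarrow> distinct (snd e) \<and> 2 \<le> length (snd e)" and k: "0 < k"
    and hyp: "\<And>r. \<exists>H. ramsey_hypergraph (n div 2) (r + 2) k H"
    and S: "finite S"
  shows "\<exists>T \<pi>. sparse_system n k S D T \<pi>"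
  using S
proof (induction S)
  case empty
  show ?case by (rule disjoint_copies[OF D(1) k])
next
  case (insert d S)
  then obtain T \<pi> where "sparse_system n k S D T \<pi>" by blast
  then show ?case by (rule amalgamate[OF _ D(2) hyp])
qed

lemma pigeonhole_fibre:
  fixes f :: "nat \<Rightarrow> nat"
  assumes f: "\<And>m. f m < k"
  shows "\<exists>c<k. L \<le> card {m. m < k * L \<and> f m = c}"
proof (rule ccontr)
  assume "\<not> ?thesis"
  then have less: "card {m. m < k * L \<and> f m = c} < L" if "c < k" for c
    using that by (auto simp: not_le)
  have "k \<noteq> 0" using f[of 0] by simp
  have "{..<k * L} = (\<Union>c<k. {m. m < k * L \<and> f m = c})" using f by auto
  then have "k * L \<le> (\<Sum>c<k. card {m. m < k * L \<and> f m = c})"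
    by (metis card_UN_le card_lessThan finite_lessThan)
  also have "\<dots> < (\<Sum>c<k. L)"
    using less \<open>k \<noteq> 0\<close> by (intro sum_strict_mono) auto
  finally show False by simp
qed

text \<open>Blowing up every vertex into many copies makes all tuples injective, and any colouring is
  constant on sufficiently many copies of each vertex.\<close>
lemma sparse_ramsey:
  fixes D :: "('i \<times> 'd list) set"
  assumes D: "finite D" "\<And>e. e \<in> D \<Longrightarrow> 2 \<le> length (snd e)" and k: "0 < k"
    and hyp: "\<And>r. \<exists>H. ramsey_hypergraph (n div 2) (r + 2) k H"
  shows "\<exists>T \<pi>. sparse_system n k UNIV D T \<pi> \<and> (\<forall>u\<in>T. distinct (snd u))"
proof -
  obtain L where L: "\<And>e. e \<in> D \<Longrightarrow> length (snd e) \<le> L"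
    using D(1) by (metis (no_types, lifting) Max_ge finite_imageI imageI)
  define D' :: "('i \<times> ('d \<times> nat) list) set" where
    "D' = {u. map_tup fst u \<in> D \<and> distinct (snd u) \<and> snd ` set (snd u) \<subseteq> {..<k * L}}"
  have D': "distinct (snd u) \<and> 2 \<le> length (snd u)" if "u \<in> D'" for u
    using that D(2)[of "map_tup fst u"] by (auto simp: D'_def)
  have "finite D'"
  proof (rule finite_subset)
    let ?V = "verts D \<times> {..<k * L}"
    show "D' \<subseteq> fst ` D \<times> {zs. set zs \<subseteq> ?V \<and> length zs \<le> L}"
    proof
      fix u assume u: "u \<in> D'"
      then have mem: "map_tup fst u \<in> D" by (simp add: D'_def)
      have "set (snd (map_tup fst u)) \<subseteq> verts D" using mem by blast
      then have "fst ` set (snd u) \<subseteq> verts D" by simp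
      moreover have "snd ` set (snd u) \<subseteq> {..<k * L}" using u by (simp add: D'_def)
      ultimately have "z \<in> ?V" if "z \<in> set (snd u)" for z
        using that unfolding mem_Times_iff by blast
      then have "set (snd u) \<subseteq> ?V" by blast
      moreover have "fst u \<in> fst ` D" using imageI[OF mem, of fst] by simp
      moreover have "length (snd u) \<le> L" using L[OF mem] by simp
      ultimately show "u \<in> fst ` D \<times> {zs. set zs \<subseteq> ?V \<and> length zs \<le> L}"
        by (simp add: mem_Times_iff)
    qed
    show "finite (fst ` D \<times> {zs. set zs \<subseteq> ?V \<and> length zs \<le> L})"
      using D(1) by (intro finite_cartesian_product finite_lists_length_le) auto
  qed
  then obtain T \<pi> where sys: "sparse_system n k (verts D') D' T \<pi>"
    using partite_system[OF _ D' k hyp, of D' "verts D'"] by auto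
  then have T: "finite T" "sparse n T" "map_tup \<pi> ` T \<subseteq> D'" "arrows k (verts D') D' T \<pi>"
    unfolding sparse_system_def by blast+
  have comp: "map_tup (fst \<circ> \<pi>) u = map_tup fst (map_tup \<pi> u)" for u :: "'i \<times> nat list"
    by (simp add: map_tup_def)
  have "map_tup (fst \<circ> \<pi>) ` T \<subseteq> D" using T(3) unfolding comp D'_def by auto
  moreover have "arrows k UNIV D T (fst \<circ> \<pi>)"
    unfolding arrows_def
  proof (intro allI impI)
    fix \<chi> :: "nat \<Rightarrow> nat" assume \<chi>: "\<forall>v. \<chi> v < k"
    have "\<exists>\<phi>. (\<forall>d. \<phi> d < k) \<and> (\<forall>e\<in>D'. \<exists>u\<in>T. map_tup \<pi> u = e \<and>
        (\<forall>y\<in>set (snd u). \<pi> y \<in> verts D' \<longrightarrow> \<chi> y = \<phi> (\<pi> y)))"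
      by (rule mp[OF spec[OF T(4)[unfolded arrows_def]] \<chi>])
    then obtain \<phi>' where \<phi>': "\<And>d. \<phi>' d < k" "\<And>e. e \<in> D' \<Longrightarrow> \<exists>u\<in>T. map_tup \<pi> u = e \<and>
        (\<forall>y\<in>set (snd u). \<pi> y \<in> verts D' \<longrightarrow> \<chi> y = \<phi>' (\<pi> y))" by blast
    have "\<forall>d. \<exists>c<k. L \<le> card {m. m < k * L \<and> \<phi>' (d, m) = c}"
      using pigeonhole_fibre[of "\<lambda>m. \<phi>' (_, m)"] \<phi>'(1) by blast
    from choice[OF this] obtain \<phi>
      where \<phi>: "\<And>d. \<phi> d < k" "\<And>d. L \<le> card {m. m < k * L \<and> \<phi>' (d, m) = \<phi> d}" by blast
    have "\<exists>g. g ` {..<L} \<subseteq> {m. m < k * L \<and> \<phi>' (d, m) = \<phi> d} \<and> inj_on g {..<L}" for d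
      using \<phi>(2)[of d] card_le_inj[of "{..<L}" "{m. m < k * L \<and> \<phi>' (d, m) = \<phi> d}"] by simp
    then have "\<forall>d. \<exists>g. g ` {..<L} \<subseteq> {m. m < k * L \<and> \<phi>' (d, m) = \<phi> d} \<and> inj_on g {..<L}" by blast
    from choice[OF this] obtain g
      where g: "\<And>d. g d ` {..<L} \<subseteq> {m. m < k * L \<and> \<phi>' (d, m) = \<phi> d}" "\<And>d. inj_on (g d) {..<L}"
      by blast
    have "\<exists>u\<in>T. map_tup (fst \<circ> \<pi>) u = e \<and>
        (\<forall>y\<in>set (snd u). (fst \<circ> \<pi>) y \<in> UNIV \<longrightarrow> \<chi> y = \<phi> ((fst \<circ> \<pi>) y))" if e: "e \<in> D" for e
    proof -
      define xs where "xs = snd e"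
      define zs where "zs = map (\<lambda>p. (xs ! p, g (xs ! p) p)) [0..<length xs]"
      have len: "p < L" if "p < length xs" for p using L[OF e] that by (simp add: xs_def)
      have fst_zs: "map fst zs = xs" by (simp add: zs_def comp_def map_nth)
      have "distinct zs"
        unfolding zs_def distinct_map
        using inj_onD[OF g(2)] len by (auto simp: inj_on_def)
      moreover have zs_g: "m < k * L \<and> \<phi>' (d, m) = \<phi> d" if dm: "(d, m) \<in> set zs" for d m
      proof -
        obtain p where "p < length xs" "d = xs ! p" "m = g d p" using dm by (auto simp: zs_def)
        then show ?thesis using g(1)[of d] len[of p] by blast
      qed
      ultimately have zsD': "(fst e, zs) \<in> D'"
        using e by (auto simp: D'_def fst_zs xs_def)
      then obtain u where u: "u \<in> T" "map_tup \<pi> u = (fst e, zs)"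
        "\<forall>y\<in>set (snd u). \<pi> y \<in> verts D' \<longrightarrow> \<chi> y = \<phi>' (\<pi> y)" using \<phi>'(2) by blast
      have zs: "zs = map \<pi> (snd u)" using u(2) by (simp add: map_tup_def)
      have "\<chi> y = \<phi> (fst (\<pi> y))" if y: "y \<in> set (snd u)" for y
      proof -
        have "\<pi> y \<in> set zs" using y by (simp add: zs)
        then show ?thesis using u(3) y zsD' zs_g[of "fst (\<pi> y)" "snd (\<pi> y)"] by fastforce
      qed
      moreover have "map_tup (fst \<circ> \<pi>) u = e"
        unfolding comp u(2) by (simp add: fst_zs xs_def)
      ultimately show ?thesis using u(1) by auto
    qed
    then show "\<exists>\<phi>. (\<forall>d. \<phi> d < k) \<and> (\<forall>e\<in>D. \<exists>u\<in>T. map_tup (fst \<circ> \<pi>) u = e \<and>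
        (\<forall>y\<in>set (snd u). (fst \<circ> \<pi>) y \<in> UNIV \<longrightarrow> \<chi> y = \<phi> ((fst \<circ> \<pi>) y)))"
      using \<phi>(1) by blast
  qed
  moreover have "\<forall>u\<in>T. distinct (snd u)"
    using T(3) D' by (metis distinct_map image_subset_iff map_tup_simps(2))
  ultimately show ?thesis using T(1,2) unfolding sparse_system_def by blast
qed

text \<open>A Ramsey hypergraph is a sparse system over a single loop. Its construction consumes sparse
  hypergraphs of half the girth only, so the recursion ends with complete hypergraphs.\<close>
lemma ramsey_hypergraph_exists:
  assumes k: "0 < k"
  shows "\<exists>H. ramsey_hypergraph n (r + 2) k H"
proof (induction n arbitrary: r rule: less_induct)
  case (less n)
  show ?case
  proof (cases "n = 0")
    case True
    define H where "H = {ys. set ys \<subseteq> {..<k * (r + 2)} \<and> length ys = r + 2 \<and> distinct ys}"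
    have "finite H"
      by (rule finite_subset[OF _ finite_lists_length_eq[of "{..<k * (r + 2)}" "r + 2"]])
        (auto simp: H_def)
    moreover have "\<exists>ys\<in>H. \<forall>y\<in>set ys. \<chi> y = \<chi> (hd ys)" if \<chi>: "\<forall>v. \<chi> v < k" for \<chi> :: "nat \<Rightarrow> nat"
    proof -
      obtain c where c: "r + 2 \<le> card {m. m < k * (r + 2) \<and> \<chi> m = c}"
        using pigeonhole_fibre[of \<chi> k "r + 2"] \<chi> by blast
      then obtain A where A: "A \<subseteq> {m. m < k * (r + 2) \<and> \<chi> m = c}" "card A = r + 2" "finite A"
        by (meson obtain_subset_with_card_n)
      then obtain ys where ys: "set ys = A" "distinct ys" using finite_distinct_list by blast
      have "length ys = r + 2" using ys A(2) distinct_card by metis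
      then have "ys \<in> H" "hd ys \<in> A" using ys A(1) by (auto simp: H_def intro!: hd_in_set)
      then show ?thesis using ys(1) A(1) by (intro bexI[of _ ys]) auto
    qed
    moreover have "sparse n (Pair () ` H)" using True unfolding sparse_def by auto
    ultimately have "ramsey_hypergraph n (r + 2) k H"
      unfolding ramsey_hypergraph_def by (auto simp: H_def)
    then show ?thesis by blast
  next
    case False
    define D :: "(unit \<times> unit list) set" where "D = {((), replicate (r + 2) ())}"
    have "\<exists>H. ramsey_hypergraph (n div 2) (s + 2) k H" for s
      using less False by simp
    then obtain T \<pi> where sys: "sparse_system n k UNIV D T \<pi>" "\<forall>u\<in>T. distinct (snd u)"
      using sparse_ramsey[of D k n] k by (auto simp: D_def)
    then have T: "finite T" "sparse n T" "map_tup \<pi> ` T \<subseteq> D" "arrows k UNIV D T \<pi>"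
      unfolding sparse_system_def by blast+
    have eq: "Pair () ` snd ` T = T" by (force simp: image_image)
    have "length (snd u) = r + 2" if "u \<in> T" for u
    proof -
      have "map_tup \<pi> u \<in> D" using T(3) that by blast
      then have "map \<pi> (snd u) = replicate (r + 2) ()" by (simp add: D_def map_tup_def)
      then show ?thesis by (metis length_map length_replicate)
    qed
    moreover have "\<exists>ys\<in>snd ` T. \<forall>y\<in>set ys. \<chi> y = \<chi> (hd ys)"
      if \<chi>: "\<forall>v. \<chi> v < k" for \<chi> :: "nat \<Rightarrow> nat"
    proof -
      have "\<exists>\<phi>. (\<forall>d. \<phi> d < k) \<and> (\<forall>e\<in>D. \<exists>u\<in>T. map_tup \<pi> u = e \<and>
          (\<forall>y\<in>set (snd u). \<pi> y \<in> UNIV \<longrightarrow> \<chi> y = \<phi> (\<pi> y)))"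
        by (rule mp[OF spec[OF T(4)[unfolded arrows_def]] \<chi>])
      then obtain \<phi> u where u: "u \<in> T" "\<forall>y\<in>set (snd u). \<chi> y = \<phi> (\<pi> y)" by (auto simp: D_def)
      have "\<pi> y = \<pi> y'" for y y' by simp
      then have "\<forall>y\<in>set (snd u). \<chi> y = \<chi> (hd (snd u))"
        using u(2) by (metis empty_iff hd_in_set list.set(1))
      then show ?thesis using u(1) by blast
    qed
    ultimately have "ramsey_hypergraph n (r + 2) k (snd ` T)"
      using T(1,2) sys(2) unfolding ramsey_hypergraph_def eq by auto
    then show ?thesis by blast
  qed
qed

text \<open>A homomorphism from \<open>X\<close> to \<open>H\<close> is a colouring of \<open>X\<close>, and the Ramsey property turns it into a
  homomorphism from \<open>D\<close> to \<open>H\<close>.\<close>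
theorem sparse_incomparability:
  fixes D :: "(nat, 'i) struct" and \<H> :: "(nat, 'i) struct set"
  assumes I: "finite I" and pos: "\<And>i. i \<in> I \<Longrightarrow> \<delta> i \<ge> 2" and D: "is_structure I \<delta> D"
    and H: "finite \<H>" "\<And>H. H \<in> \<H> \<Longrightarrow> is_structure I \<delta> H \<and> \<not> hom_to I D H"
  shows "\<exists>X :: (nat, 'i) struct. is_structure I \<delta> X \<and> hom_to I X D \<and> sparse n (tups X) \<and>
    (\<forall>H\<in>\<H>. \<not> hom_to I X H)"
proof -
  define k where "k = Suc (\<Sum>H\<in>\<H>. card (base H))"
  have k: "card (base H) < k" if "H \<in> \<H>" for H
    using member_le_sum[OF that, of "\<lambda>H. card (base H)"] assms(4) by (simp add: k_def less_Suc_eq_le)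
  have "0 < k" by (simp add: k_def)
  have len: "2 \<le> length (snd e)" if "e \<in> tups D" for e
    using that is_structureD(3,4)[OF D] pos unfolding tups_def by fastforce
  obtain T \<pi> where "sparse_system n k UNIV (tups D) T \<pi>"
    using sparse_ramsey[OF finite_tups[OF D I] len \<open>0 < k\<close> ramsey_hypergraph_exists[OF \<open>0 < k\<close>]] by blast
  then have T: "finite T" "sparse n T" "map_tup \<pi> ` T \<subseteq> tups D" "arrows k UNIV (tups D) T \<pi>"
    unfolding sparse_system_def by blast+
  obtain d0 where d0: "d0 \<in> base D" using is_structureD(2)[OF D] by blast
  have TD: "map \<pi> xs \<in> rels D i" if "(i, xs) \<in> T" for i xs
    using T(3) that by (force simp: tups_def map_tup_def)
  \<comment> \<open>The extra vertex keeps the base set non-empty when there are no tuples.\<close>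
  define X where "X = Struct (insert 0 (verts T)) (\<lambda>i. {xs. (i, xs) \<in> T})"
  have tupsX: "tups X = T" by (simp add: tups_def X_def)
  have "is_structure I \<delta> X"
  proof (rule is_structureI)
    show "finite (base X)" "base X \<noteq> {}" using T(1) by (simp_all add: X_def)
    show "i \<in> I \<and> length xs = \<delta> i \<and> set xs \<subseteq> base X" if "xs \<in> rels X i" for i xs
      using that TD[of i xs] is_structureD(3,4)[OF D, of "map \<pi> xs" i] by (force simp: X_def)
  qed
  moreover have "hom_to I X D"
  proof -
    have *: "\<pi> v \<in> base D" if v: "v \<in> verts T" for v
    proof -
      obtain i xs where "(i, xs) \<in> T" "v \<in> set xs" using v by auto
      then show ?thesis using is_structureD(5)[OF D TD[of i xs]] by auto
    qed
    define \<rho> where "\<rho> v = (if v \<in> verts T then \<pi> v else d0)" for v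
    have "\<rho> v \<in> base D" for v using * d0 by (simp add: \<rho>_def)
    moreover have "map \<rho> xs \<in> rels D i" if "(i, xs) \<in> T" for i xs
    proof -
      have "map \<rho> xs = map \<pi> xs" using that by (intro map_cong) (force simp: \<rho>_def)+
      then show ?thesis using TD[OF that] by (simp only:)
    qed
    ultimately have "is_hom I \<rho> X D" by (intro is_homI) (simp_all add: X_def)
    then show ?thesis unfolding hom_to_def by blast
  qed
  moreover have "\<not> hom_to I X H" if HH: "H \<in> \<H>" for H
  proof
    assume "hom_to I X H"
    then obtain f where f: "is_hom I f X H" unfolding hom_to_def by blast
    have Hs: "is_structure I \<delta> H" using assms(5)[OF HH] by blast
    obtain idx where idx: "bij_betw idx (base H) {0..<card (base H)}"
      using ex_bij_betw_finite_nat[OF is_structureD(1)[OF Hs]] by blast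
    define \<chi> where "\<chi> v = (if v \<in> base X then idx (f v) else 0)" for v
    have "\<forall>v. \<chi> v < k"
      using bij_betwE[OF idx] is_hom_base[OF f] k[OF HH] by (force simp: \<chi>_def)
    then have "\<exists>\<phi>. (\<forall>d. \<phi> d < k) \<and> (\<forall>e\<in>tups D. \<exists>u\<in>T. map_tup \<pi> u = e \<and>
        (\<forall>y\<in>set (snd u). \<pi> y \<in> UNIV \<longrightarrow> \<chi> y = \<phi> (\<pi> y)))"
      by (rule mp[OF spec[OF T(4)[unfolded arrows_def]]])
    then obtain \<phi> where \<phi>: "\<And>e. e \<in> tups D \<Longrightarrow> \<exists>u\<in>T. map_tup \<pi> u = e \<and>
        (\<forall>y\<in>set (snd u). \<chi> y = \<phi> (\<pi> y))" by auto
    obtain h0 where h0: "h0 \<in> base H" using is_structureD(2)[OF Hs] by blast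
    define g where "g d = (if \<phi> d \<in> idx ` base H then inv_into (base H) idx (\<phi> d) else h0)" for d
    have "is_hom I g D H"
    proof (rule is_homI)
      show "g v \<in> base H" for v using h0 by (auto simp: g_def inv_into_into)
      fix i xs assume i: "i \<in> I" and xs: "xs \<in> rels D i"
      obtain u where u: "u \<in> T" "map_tup \<pi> u = (i, xs)" "\<forall>y\<in>set (snd u). \<chi> y = \<phi> (\<pi> y)"
        using \<phi>[of "(i, xs)"] xs by (auto simp: tups_def)
      have ux: "fst u = i" "xs = map \<pi> (snd u)" using u(2) by (simp_all add: map_tup_def)
      have "g (\<pi> y) = f y" if y: "y \<in> set (snd u)" for y
      proof -
        have "y \<in> base X" using y u(1) by (auto simp: X_def)
        then have "\<phi> (\<pi> y) = idx (f y)" "f y \<in> base H"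
          using u(3) y is_hom_base[OF f] by (auto simp: \<chi>_def)
        then show ?thesis using bij_betw_imp_inj_on[OF idx] by (simp add: g_def)
      qed
      then have "map g xs = map f (snd u)" by (simp add: ux(2))
      moreover have "snd u \<in> rels X i" using u(1) ux(1) by (auto simp: X_def)
      ultimately show "map g xs \<in> rels H i" using is_hom_rels[OF f i] by (simp only:)
    qed
    then show False using assms(5)[OF HH] unfolding hom_to_def by blast
  qed
  ultimately show ?thesis using T(2) tupsX by auto
qed

section \<open>Zigzags\<close>

text \<open>In a chain of tuples of one relation, consecutive tuples share position 1 and position 0 in turn;
  \<open>fold_class s p\<close> numbers the vertices in position \<open>p\<close> along the chain. Sharing the same position
  allows folding one tuple onto the other, while distant tuples have no common vertex.\<close>
definition fold_class :: "nat \<Rightarrow> nat \<Rightarrow> nat" where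
  "fold_class s p = (if p = 0 then (s + 1) div 2 else if p = 1 then s div 2 else s)"

lemma fold_class_0 [simp]: "fold_class 0 p = 0"
  by (simp add: fold_class_def)

lemma fold_class_near: "fold_class s p = fold_class s' p \<Longrightarrow> s \<le> s' + 1"
  by (simp add: fold_class_def split: if_splits)

lemma fold_class_Suc: "\<exists>p<2. fold_class (Suc s) p = fold_class s p"
proof (cases "even s")
  case True
  then show ?thesis by (intro exI[of _ 1]) (auto simp: fold_class_def)
next
  case False
  then show ?thesis by (intro exI[of _ 0]) (auto simp: fold_class_def elim!: oddE)
qed

lemma fold_class_inj: "fold_class s 0 = fold_class s' 0 \<Longrightarrow> fold_class s 1 = fold_class s' 1 \<Longrightarrow> s = s'"
proof -
  have "fold_class s 0 + fold_class s 1 = s" for s by (simp add: fold_class_def)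
  then show "fold_class s 0 = fold_class s' 0 \<Longrightarrow> fold_class s 1 = fold_class s' 1 \<Longrightarrow> s = s'" by metis
qed

text \<open>The vertex in position \<open>p\<close> of tuple \<open>s\<close> of chain \<open>x\<close>, where two chains \<open>0\<close> and \<open>1\<close> are glued at
  their initial tuples (position \<open>a\<close> to \<open>b\<close>) and at their final tuples (position \<open>a'\<close> to \<open>b'\<close>).\<close>
definition zigzag_vertex :: "nat \<Rightarrow> nat \<Rightarrow> nat \<Rightarrow> nat \<Rightarrow> nat \<Rightarrow> nat \<Rightarrow> nat \<Rightarrow> nat \<Rightarrow> nat \<times> nat \<times> nat" where
  "zigzag_vertex M a b a' b' x s p = (let k = fold_class s p in
    if x = 1 \<and> p = b \<and> k = 0 then (0, a, 0)
    else if x = 1 \<and> p = b' \<and> k = fold_class M b' then (0, a', fold_class M a')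
    else (x, p, k))"

text \<open>Two disjoint junctions \<open>t = 0\<close> and \<open>t = 1\<close>: the first tuple (\<open>x = 0\<close>) and the second tuple (\<open>x = 1\<close>)
  share position \<open>a\<close> and \<open>b\<close>, respectively \<open>a'\<close> and \<open>b'\<close>.\<close>
definition junction_vertex :: "nat \<Rightarrow> nat \<Rightarrow> nat \<Rightarrow> nat \<Rightarrow> nat \<Rightarrow> nat \<Rightarrow> nat \<Rightarrow> nat \<times> nat \<times> nat" where
  "junction_vertex a b a' b' x t p =
    (if x = 1 \<and> t = 0 \<and> p = b then (0, 0, a)
     else if x = 1 \<and> t = 1 \<and> p = b' then (1, 0, a')
     else (t, x, p))"

lemma junction_vertex_0 [simp]: "junction_vertex a b a' b' 0 t p = (t, 0, p)"
  by (simp add: junction_vertex_def)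

lemma inj_junction_vertex: "inj (junction_vertex a b a' b' x t)"
  by (auto simp: inj_on_def junction_vertex_def split: if_splits)

text \<open>The relations \<open>i\<close> and \<open>j\<close> may coincide. The last assumption says that two progressions cannot meet
  in both prescribed ways.\<close>
locale junction_pair =
  fixes I :: "'i set" and \<delta> :: "'i \<Rightarrow> nat" and q :: "('a, 'i) struct" and st :: "'i \<Rightarrow> int"
    and i j :: 'i and a b a' b' :: nat and e f :: "nat \<Rightarrow> 'a list"
  assumes q: "is_structure I \<delta> q"
    and ij: "i \<in> I" "j \<in> I" "2 \<le> \<delta> i" "2 \<le> \<delta> j"
    and pos: "a < \<delta> i" "a' < \<delta> i" "b < \<delta> j" "b' < \<delta> j"
    and e: "\<And>t. e t \<in> rels q i" and f: "\<And>t. f t \<in> rels q j"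
    and meet: "e 0 ! a = f 0 ! b" "e 1 ! a' = f 1 ! b'"
    and clash: "st i * (int a - int a') \<noteq> st j * (int b - int b')"
begin

abbreviation "ar x \<equiv> if x = (0::nat) then \<delta> i else \<delta> j"
abbreviation "lab x \<equiv> if x = (0::nat) then i else j"

definition ztup :: "nat \<Rightarrow> nat \<Rightarrow> nat \<Rightarrow> 'i \<times> (nat \<times> nat \<times> nat) list" where
  "ztup M x s = (lab x, map (zigzag_vertex M a b a' b' x s) [0..<ar x])"

definition ptup :: "nat \<Rightarrow> nat \<Rightarrow> 'i \<times> (nat \<times> nat \<times> nat) list" where
  "ptup x t = (lab x, map (junction_vertex a b a' b' x t) [0..<ar x])"

definition zigzag :: "nat \<Rightarrow> (nat \<times> nat \<times> nat, 'i) struct" where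
  "zigzag M = Struct ({..<2} \<times> {..<\<delta> i + \<delta> j} \<times> {..Suc M})
    (\<lambda>l. {xs. \<exists>x<2. \<exists>s\<le>M. (l, xs) = ztup M x s})"

definition junctions :: "(nat \<times> nat \<times> nat, 'i) struct" where
  "junctions = Struct ({..<2} \<times> {..<2} \<times> {..<\<delta> i + \<delta> j}) (\<lambda>l. {xs. \<exists>x<2. \<exists>t<2. (l, xs) = ptup x t})"

lemma zigzag_structure: "is_structure I \<delta> (zigzag M)"
proof (rule is_structureI)
  show "finite (base (zigzag M))" "base (zigzag M) \<noteq> {}" using ij by (auto simp: zigzag_def lessThan_empty_iff)
  fix l xs assume "xs \<in> rels (zigzag M) l"
  then obtain x s where x: "x < 2" "s \<le> M" "l = lab x"
      "xs = map (zigzag_vertex M a b a' b' x s) [0..<ar x]"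
    by (auto simp: zigzag_def ztup_def)
  have "fold_class s p \<le> Suc M" if "s \<le> M" for s p
    using that by (auto simp: fold_class_def intro: le_trans[OF div_le_dividend])
  then have "zigzag_vertex M a b a' b' x s p \<in> base (zigzag M)" if "p < ar x" for p
    using that x(1,2) pos by (auto simp: zigzag_def zigzag_vertex_def Let_def split: if_splits)
  then show "l \<in> I \<and> length xs = \<delta> l \<and> set xs \<subseteq> base (zigzag M)"
    using x ij by auto
qed

lemma junctions_structure: "is_structure I \<delta> junctions"
proof (rule is_structureI)
  show "finite (base junctions)" "base junctions \<noteq> {}" using ij by (auto simp: junctions_def lessThan_empty_iff)
  fix l xs assume "xs \<in> rels junctions l"
  then obtain x t where x: "x < 2" "t < 2" "l = lab x"
      "xs = map (junction_vertex a b a' b' x t) [0..<ar x]"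
    by (auto simp: junctions_def ptup_def)
  have "junction_vertex a b a' b' x t p \<in> base junctions" if "p < ar x" for p
    using that x(1,2) pos by (auto simp: junctions_def junction_vertex_def split: if_splits)
  then show "l \<in> I \<and> length xs = \<delta> l \<and> set xs \<subseteq> base junctions"
    using x ij by auto
qed

lemma tups_junctions: "tups junctions = {ptup x t | x t. x < 2 \<and> t < 2}"
proof (rule set_eqI)
  fix u :: "'i \<times> (nat \<times> nat \<times> nat) list"
  obtain l xs where "u = (l, xs)" by (cases u)
  then show "u \<in> tups junctions \<longleftrightarrow> u \<in> {ptup x t | x t. x < 2 \<and> t < 2}"
    by (simp add: tups_def junctions_def) blast
qed

lemma junctions_sparse: "sparse n (tups junctions)"
proof -
  have lt2: "x < 2 \<longleftrightarrow> x = 0 \<or> x = Suc 0" for x :: nat by auto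
  have eq: "tups junctions = {ptup 1 1, ptup 0 1, ptup 1 0, ptup 0 0}"
    unfolding tups_junctions lt2 by auto
  have "distinct (snd (ptup x t))" for x t
    using inj_on_subset[OF inj_junction_vertex] by (simp add: ptup_def distinct_map)
  moreover have ptup_eq: "ptup x t = (lab x, snd (ptup x t))" for x t by (simp add: ptup_def)
  moreover have "set (snd (ptup 1 1)) \<inter> verts {ptup 0 1, ptup 1 0, ptup 0 0} \<subseteq> {(1, 0, a')}"
    "set (snd (ptup 0 1)) \<inter> verts {ptup 1 0, ptup 0 0} \<subseteq> {(1, 0, a')}"
    "set (snd (ptup 1 0)) \<inter> verts {ptup 0 0} \<subseteq> {(0, 0, a)}"
    "set (snd (ptup 0 0)) \<inter> verts {} \<subseteq> {(0, 0, a)}"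
    by (auto simp: ptup_def junction_vertex_def split: if_splits)
  ultimately show ?thesis unfolding eq
    using sparse_insert[of n] sparse_empty[of n] by metis
qed

lemma junctions_to_q: "hom_to I junctions q"
proof -
  define g where "g v = (case v of (t, x, p) \<Rightarrow>
    let xs = (if x = (0::nat) then e t else f t) in if p < length xs then xs ! p else xs ! 0)" for v
  have len: "length (e t) = \<delta> i" "length (f t) = \<delta> j" for t
    using is_structureD(4)[OF q] e f by blast+
  have g_e: "g (t, 0, p) = e t ! p" if "p < \<delta> i" for t p using that by (simp add: g_def len)
  have g_f: "g (t, 1, p) = f t ! p" if "p < \<delta> j" for t p using that by (simp add: g_def len)
  have mem: "xs ! p \<in> base q" if "xs \<in> rels q l" "p < length xs" for xs l p
    using is_structureD(5)[OF q that(1)] that(2) by auto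
  have "is_hom I g junctions q"
  proof (rule is_homI)
    fix v assume "v \<in> base junctions"
    obtain t x p where v: "v = (t, x, p)" by (cases v)
    have "0 < length (e t)" "0 < length (f t)" using len ij by auto
    then show "g v \<in> base q"
      using mem[OF e] mem[OF f] by (simp add: v g_def Let_def)
  next
    fix l xs assume "xs \<in> rels junctions l"
    then obtain x t where x: "x < 2" "t < 2" "l = lab x"
        "xs = map (junction_vertex a b a' b' x t) [0..<ar x]"
      by (auto simp: junctions_def ptup_def)
    show "map g xs \<in> rels q l"
    proof (cases "x = 0")
      case True
      have "map g xs = e t"
        unfolding x(4) using True g_e len by (intro nth_equalityI) auto
      then show ?thesis using e True x(3) by simp
    next
      case False
      then have x1: "x = 1" using x(1) by simp
      have "g (junction_vertex a b a' b' 1 t p) = f t ! p" if "p < \<delta> j" for p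
        using that g_f g_e pos meet x(2) by (auto simp: junction_vertex_def)
      then have "map g xs = f t"
        unfolding x(4) using x1 len by (intro nth_equalityI) auto
      then show ?thesis using f x1 x(3) by simp
    qed
  qed
  then show ?thesis unfolding hom_to_def by blast
qed

text \<open>Consecutive tuples of a chain share a position, so they become the same progression. The two
  junctions would then be realised by the same pair of progressions.\<close>
lemma zigzag_no_potential:
  assumes M: "2 \<le> M"
  shows "\<not> has_potential I \<delta> st (zigzag M)"
proof
  assume "has_potential I \<delta> st (zigzag M)"
  then obtain h where h: "\<And>l xs. l \<in> I \<Longrightarrow> xs \<in> rels (zigzag M) l \<Longrightarrow> \<exists>x. map h xs = progression \<delta> st l x"
    unfolding has_potential_def by blast
  have "\<exists>c. \<forall>p<ar x. h (zigzag_vertex M a b a' b' x s p) = c + st (lab x) * int p"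
    if xs: "x < 2" "s \<le> M" for x s
  proof -
    have "map (zigzag_vertex M a b a' b' x s) [0..<ar x] \<in> rels (zigzag M) (lab x)"
      unfolding zigzag_def struct.sel mem_Collect_eq ztup_def[symmetric] using xs by blast
    moreover have "lab x \<in> I" using ij by simp
    ultimately obtain c where
      c: "map h (map (zigzag_vertex M a b a' b' x s) [0..<ar x]) = progression \<delta> st (lab x) c"
      using h by blast
    have "h (zigzag_vertex M a b a' b' x s p) = c + st (lab x) * int p" if p: "p < ar x" for p
    proof -
      have "map h (map (zigzag_vertex M a b a' b' x s) [0..<ar x]) ! p = progression \<delta> st (lab x) c ! p"
        by (simp only: c)
      then show ?thesis using p by (auto simp: progression_def split: if_splits)
    qed
    then show ?thesis by blast
  qed
  then have "\<forall>x s. \<exists>c. x < 2 \<longrightarrow> s \<le> M \<longrightarrow>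
      (\<forall>p<ar x. h (zigzag_vertex M a b a' b' x s p) = c + st (lab x) * int p)" by blast
  then obtain c where c: "\<And>x s p. x < 2 \<Longrightarrow> s \<le> M \<Longrightarrow> p < ar x \<Longrightarrow>
      h (zigzag_vertex M a b a' b' x s p) = c x s + st (lab x) * int p" by metis
  have const: "s \<le> M \<Longrightarrow> c x s = c x 0" if x: "x < 2" for x s
  proof (induction s)
    case (Suc s)
    obtain p where p: "p < 2" "fold_class (Suc s) p = fold_class s p" using fold_class_Suc by blast
    have "zigzag_vertex M a b a' b' x (Suc s) p = zigzag_vertex M a b a' b' x s p"
      by (simp add: zigzag_vertex_def p(2))
    moreover have "p < ar x" using p(1) ij by auto
    ultimately have "c x (Suc s) = c x s" using c[OF x, of s p] c[OF x, of "Suc s" p] Suc.prems by simp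
    then show ?case using Suc by simp
  qed simp
  have "fold_class M b' \<noteq> 0" using M by (auto simp: fold_class_def)
  then have "zigzag_vertex M a b a' b' 1 0 b = zigzag_vertex M a b a' b' 0 0 a"
    "zigzag_vertex M a b a' b' 1 M b' = zigzag_vertex M a b a' b' 0 M a'"
    by (simp_all add: zigzag_vertex_def Let_def)
  then have "c 1 0 + st j * int b = c 0 0 + st i * int a" "c 1 M + st j * int b' = c 0 M + st i * int a'"
    using c[of 1 0 b] c[of 0 0 a] c[of 1 M b'] c[of 0 M a'] pos by simp_all
  then have "st i * (int a - int a') = st j * (int b - int b')"
    using const[of 1 M] const[of 0 M] by (simp add: algebra_simps)
  then show False using clash by blast
qed

lemma ztup_inj:
  assumes M: "2 \<le> M" and x: "x < 2"
  shows "inj_on (ztup M x) {..M}"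
proof (rule inj_onI)
  fix s s' assume eq: "ztup M x s = ztup M x s'"
  have ne: "fold_class M a' \<noteq> 0" using M by (auto simp: fold_class_def)
  have "fold_class s p = fold_class s' p" if "p < 2" for p
  proof -
    have "p < ar x" using that ij by auto
    then have "zigzag_vertex M a b a' b' x s p = zigzag_vertex M a b a' b' x s' p"
      using eq by (simp add: ztup_def map_eq_conv split: if_splits)
    then show ?thesis using ne unfolding zigzag_vertex_def Let_def
      by (simp split: if_splits)
  qed
  then show "s = s'" using fold_class_inj by simp
qed

text \<open>Few tuples leave a gap inside each of the two chains. Between the gaps every chain folds onto
  a single tuple, so what remains folds onto the two junctions.\<close>
lemma zigzag_local:
  assumes E: "E \<subseteq> tups (zigzag M)" "finite E" "card E \<le> n" and M: "M = n + 2"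
  shows "\<exists>g. (\<forall>v\<in>base (zigzag M). g v \<in> base junctions) \<and> map_tup g ` E \<subseteq> tups junctions"
proof -
  have gap: "\<exists>m. 0 < m \<and> m < M \<and> ztup M x m \<notin> E" if x: "x < 2" for x
  proof (rule ccontr)
    assume "\<not> ?thesis"
    then have "ztup M x ` {0<..<M} \<subseteq> E" by auto
    then have "card (ztup M x ` {0<..<M}) \<le> n" using card_mono[OF E(2)] E(3) by (meson order_trans)
    moreover have "inj_on (ztup M x) {0<..<M}"
      by (rule inj_on_subset[OF ztup_inj[OF _ x]]) (auto simp: M)
    ultimately show False by (simp add: card_image M)
  qed
  obtain m0 m1 where m: "0 < m0" "m0 < M" "ztup M 0 m0 \<notin> E" "0 < m1" "m1 < M" "ztup M 1 m1 \<notin> E"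
    using gap[of 0] gap[of 1] by auto
  define m where "m x = (if x = (0::nat) then m0 else m1)" for x
  have m_bounds: "0 < m x" "m x < M" for x using m by (simp_all add: m_def)
  have m_gap: "ztup M x (m x) \<notin> E" if "x < 2" for x
    using that m by (cases "x = 0") (auto simp: m_def less_2_cases_iff)
  define sd where "sd x p k = (if \<exists>s<m x. fold_class s p = k then 0 else 1::nat)" for x p k
  define g where "g v = (case v of (x, p, k) \<Rightarrow> junction_vertex a b a' b' x (sd x p k) p)" for v
  have sd: "sd x p (fold_class s p) = (if s < m x then 0 else 1)" if "s \<noteq> m x" for x p s
  proof (cases "s < m x")
    case True
    then show ?thesis by (auto simp: sd_def)
  next
    case False
    have "fold_class s' p \<noteq> fold_class s p" if "s' < m x" for s'
      using fold_class_near[of s p s'] that False \<open>s \<noteq> m x\<close> by auto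
    then show ?thesis using False by (auto simp: sd_def)
  qed
  have g_z: "g (zigzag_vertex M a b a' b' x s p) = junction_vertex a b a' b' x (if s < m x then 0 else 1) p"
    if xs: "x < 2" "s \<noteq> m x" "s \<le> M" for x s p
  proof -
    consider (left) "x = 1" "p = b" "fold_class s p = 0"
      | (right) "x = 1" "p = b'" "fold_class s p = fold_class M b'" "\<not> (p = b \<and> fold_class s p = 0)"
      | (free) "\<not> (x = 1 \<and> p = b \<and> fold_class s p = 0)"
          "\<not> (x = 1 \<and> p = b' \<and> fold_class s p = fold_class M b')"
      by metis
    then show ?thesis
    proof cases
      case left
      have "s \<le> 1" using fold_class_near[of s p 0] left by simp
      then have "s < m x" using m_bounds(1)[of x] xs(2) by linarith
      moreover have "sd 0 a 0 = 0" using sd[of 0 0 a] m_bounds(1)[of 0] by simp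
      moreover have "zigzag_vertex M a b a' b' x s p = (0, a, 0)"
        using left by (simp add: zigzag_vertex_def)
      ultimately show ?thesis using left by (simp add: g_def junction_vertex_def)
    next
      case right
      have "M \<le> s + 1" using fold_class_near[of M b' s] right by simp
      then have "m x < s" using m_bounds(2)[of x] xs(2) by linarith
      moreover have "sd 0 a' (fold_class M a') = 1" using sd[of M 0 a'] m_bounds(2)[of 0] by simp
      moreover have "zigzag_vertex M a b a' b' x s p = (0, a', fold_class M a')"
        using right by (auto simp: zigzag_vertex_def Let_def)
      ultimately show ?thesis using right by (simp add: g_def junction_vertex_def)
    next
      case free
      then have "zigzag_vertex M a b a' b' x s p = (x, p, fold_class s p)"
        unfolding zigzag_vertex_def Let_def by (simp only: if_False)
      then show ?thesis using sd[OF xs(2), of p] by (simp add: g_def)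
    qed
  qed
  have "g v \<in> base junctions" if v: "v \<in> base (zigzag M)" for v
    using v pos by (auto simp: g_def zigzag_def junctions_def junction_vertex_def sd_def)
  moreover have "map_tup g ` E \<subseteq> tups junctions"
  proof
    fix u assume "u \<in> map_tup g ` E"
    then obtain w where w: "w \<in> E" "u = map_tup g w" by blast
    then obtain x s where x: "x < 2" "s \<le> M" "w = ztup M x s"
      using E(1) by (fastforce simp: tups_def zigzag_def)
    have "s \<noteq> m x" using m_gap[OF x(1)] w(1) x(3) by blast
    then have "u = ptup x (if s < m x then 0 else 1)"
      using g_z[OF x(1) _ x(2)] by (simp add: w(2) x(3) ztup_def ptup_def map_tup_def)
    moreover have "(if s < m x then 0 else 1) < (2 :: nat)" by simp
    ultimately show "u \<in> tups junctions" using x(1) unfolding tups_junctions by blast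
  qed
  ultimately show ?thesis by blast
qed

end

section \<open>Non-forests in finite maximal antichains have no potential\<close>

text \<open>For such steps two progressions of different relations share at most one value.\<close>
definition separating :: "'i set \<Rightarrow> ('i \<Rightarrow> nat) \<Rightarrow> ('i \<Rightarrow> int) \<Rightarrow> bool" where
  "separating I \<delta> st \<longleftrightarrow> (\<forall>i\<in>I. st i \<noteq> 0) \<and>
    (\<forall>i\<in>I. \<forall>j\<in>I. i \<noteq> j \<longrightarrow> (\<forall>a a' b b'. a < \<delta> i \<longrightarrow> a' < \<delta> i \<longrightarrow> b < \<delta> j \<longrightarrow> b' < \<delta> j \<longrightarrow>
      st i * (int a - int a') = st j * (int b - int b') \<longrightarrow> a = a' \<and> b = b'))"

lemma card_le_2_eq:
  assumes "finite I" "card I \<le> 2" "i \<in> I" "j \<in> I" "i \<noteq> j"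
  shows "I = {i, j}"
  using card_seteq[of I "{i, j}"] assms by simp

lemma separating_exists:
  assumes "finite I" "card I \<le> 2" and pos: "\<And>i. i \<in> I \<Longrightarrow> \<delta> i \<ge> 2"
  shows "\<exists>st. separating I \<delta> st"
proof (cases "I = {}")
  case True
  then show ?thesis by (simp add: separating_def)
next
  case False
  then obtain c where c: "c \<in> I" by blast
  \<comment> \<open>In base \<open>\<delta> c\<close>, one relation counts units and the other one the next digit.\<close>
  define st where "st i = (if i = c then 1 else int (\<delta> c))" for i
  have key: "a = a' \<and> b = b'"
    if "a < \<delta> c" "a' < \<delta> c" and eq: "int a - int a' = int (\<delta> c) * (int b - int b')" for a a' b b'
  proof -
    have "int (\<delta> c) dvd int a - int a'" using eq by simp
    moreover have "\<bar>int a - int a'\<bar> < int (\<delta> c)" using that by linarith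
    ultimately have "int a - int a' = 0" by (metis dvd_imp_le_int abs_of_nat not_le)
    then show ?thesis using eq pos[OF c] by auto
  qed
  have "separating I \<delta> st"
    unfolding separating_def
  proof (intro conjI ballI impI allI)
    show "st i \<noteq> 0" for i using pos[OF c] by (simp add: st_def)
  next
    fix i j a a' b b'
    assume ij: "i \<in> I" "j \<in> I" "i \<noteq> j" and l: "a < \<delta> i" "a' < \<delta> i" "b < \<delta> j" "b' < \<delta> j"
      and eq: "st i * (int a - int a') = st j * (int b - int b')"
    have "c = i \<or> c = j" using card_le_2_eq[OF assms(1,2) ij] c by blast
    then have "a = a' \<and> b = b'"
    proof
      assume "c = i"
      then show ?thesis using key[of a a' b b'] l eq ij(3) by (simp add: st_def)
    next
      assume "c = j"
      then show ?thesis using key[of b b' a a'] l eq ij(3) by (simp add: st_def)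
    qed
    then show "a = a'" "b = b'" by blast+
  qed
  then show ?thesis by blast
qed

definition junction :: "('a, 'i) struct \<Rightarrow> ('i \<Rightarrow> nat) \<Rightarrow> 'i \<Rightarrow> nat \<Rightarrow> 'i \<Rightarrow> nat \<Rightarrow> 'a list \<Rightarrow> 'a list \<Rightarrow> bool" where
  "junction q \<delta> i a j b e f \<longleftrightarrow>
    e \<in> rels q i \<and> f \<in> rels q j \<and> a < \<delta> i \<and> b < \<delta> j \<and> e ! a = f ! b"

text \<open>Without two clashing junctions, a vertex occurs in at most one position of each relation, and the
  two relations meet in at most one pair of positions. Then one tuple of each relation, chosen to
  share a vertex if possible, forms a forest in \<open>q\<close> onto which all of \<open>q\<close> folds. Three relations
  could close up to a cycle here.\<close>
lemma forestlike_or_junctions: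
  fixes q :: "(nat, 'i) struct"
  assumes q: "is_structure I \<delta> q" and I: "finite I" "card I \<le> 2"
    and pos: "\<And>i. i \<in> I \<Longrightarrow> \<delta> i \<ge> 2" and st: "separating I \<delta> st"
    and not_forest: "\<not> forestlike I \<delta> q"
  shows "\<exists>i\<in>I. \<exists>j\<in>I. \<exists>a b a' b' e f e' f'. junction q \<delta> i a j b e f \<and> junction q \<delta> i a' j b' e' f' \<and>
    st i * (int a - int a') \<noteq> st j * (int b - int b')"
proof (rule ccontr)
  assume "\<not> ?thesis"
  then have no: "st i * (int a - int a') = st j * (int b - int b')"
    if "i \<in> I" "j \<in> I" "junction q \<delta> i a j b e f" "junction q \<delta> i a' j b' e' f'" for i j a b a' b' e f e' f'
    using that by blast
  have same: "a = b" if i: "i \<in> I" and ab: "junction q \<delta> i a i b e f" for i a b e f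
  proof -
    have "junction q \<delta> i b i a f e" using ab unfolding junction_def by auto
    from no[OF i i ab this] have "st i * (2 * (int a - int b)) = 0" by (simp add: algebra_simps)
    then show ?thesis using st i unfolding separating_def by auto
  qed
  have cross: "a = a' \<and> b = b'"
    if "i \<in> I" "j \<in> I" "i \<noteq> j" "junction q \<delta> i a j b e f" "junction q \<delta> i a' j b' e' f'"
    for i j a b a' b' e f e' f'
    using no[OF that(1,2,4,5)] st that unfolding separating_def junction_def by blast
  have sym: "junction q \<delta> j b i a f e" if "junction q \<delta> i a j b e f" for i a j b e f
    using that unfolding junction_def by auto
  have "\<exists>E. (\<forall>i\<in>I. rels q i \<noteq> {} \<longrightarrow> E i \<in> rels q i) \<and>
    (\<forall>i\<in>I. \<forall>j\<in>I. \<forall>a b e f. i \<noteq> j \<longrightarrow> junction q \<delta> i a j b e f \<longrightarrow> E i ! a = E j ! b)"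
  proof (cases "\<exists>i\<in>I. \<exists>j\<in>I. \<exists>a b e f. i \<noteq> j \<and> junction q \<delta> i a j b e f")
    case False
    have "\<forall>i\<in>I. rels q i \<noteq> {} \<longrightarrow> (SOME e. e \<in> rels q i) \<in> rels q i" by (simp add: some_in_eq)
    then show ?thesis using False by (intro exI[of _ "\<lambda>i. SOME e. e \<in> rels q i"] conjI) blast+
  next
    case True
    then obtain i j a b e f where ij: "i \<in> I" "j \<in> I" "i \<noteq> j" and J: "junction q \<delta> i a j b e f" by blast
    note I_eq = card_le_2_eq[OF I ij]
    define E where "E l = (if l = i then e else f)" for l
    have "\<forall>l\<in>I. E l \<in> rels q l" using J ij(3) unfolding I_eq E_def junction_def by auto
    moreover have "E l ! c = E m ! d"
      if lm: "l \<in> I" "m \<in> I" "l \<noteq> m" and J': "junction q \<delta> l c m d e' f'" for l m c d e' f'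
    proof -
      have "l = i \<and> m = j \<or> l = j \<and> m = i" using lm unfolding I_eq by blast
      then show ?thesis
      proof
        assume "l = i \<and> m = j"
        then show ?thesis using cross[OF ij J, of c d e' f'] J' J ij(3) by (auto simp: E_def junction_def)
      next
        assume "l = j \<and> m = i"
        then show ?thesis using cross[OF ij J, of d c f' e'] sym[OF J'] J ij(3)
          by (auto simp: E_def junction_def)
      qed
    qed
    ultimately show ?thesis by blast
  qed
  then obtain E where E: "\<And>i. i \<in> I \<Longrightarrow> rels q i \<noteq> {} \<Longrightarrow> E i \<in> rels q i"
    and E_join: "\<And>i j a b e f. i \<in> I \<Longrightarrow> j \<in> I \<Longrightarrow> i \<noteq> j \<Longrightarrow> junction q \<delta> i a j b e f \<Longrightarrow> E i ! a = E j ! b"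
    by blast
  define X where "X = Struct (base q) (\<lambda>i. if i \<in> I \<and> rels q i \<noteq> {} then {E i} else {})"
  have rels_X: "xs \<in> rels X i \<longleftrightarrow> i \<in> I \<and> rels q i \<noteq> {} \<and> xs = E i" for i xs by (simp add: X_def)
  have base_X: "base X = base q" by (simp add: X_def)
  have sub: "rels X i \<subseteq> rels q i" for i using E by (auto simp: rels_X)
  have X: "is_structure I \<delta> X"
    using is_structureD[OF q] sub by (intro is_structureI) (auto simp: base_X, blast+)
  have "is_hom I id X q" using sub by (intro is_homI) (auto simp: base_X)
  then have Xq: "hom_to I X q" unfolding hom_to_def by blast
  have qX: "hom_to I q X"
  proof -
    have uniq: "E i ! p = E j ! r"
      if "i \<in> I" "j \<in> I" "junction q \<delta> i p j r xs ys" for i j p r xs ys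
    proof (cases "i = j")
      case True
      then show ?thesis using same[OF that(2), of p r xs ys] that(3) by simp
    next
      case False
      then show ?thesis using E_join[OF that(1,2) _ that(3)] by blast
    qed
    define ok where "ok v w \<longleftrightarrow> (\<exists>i\<in>I. \<exists>xs\<in>rels q i. \<exists>p<\<delta> i. xs ! p = v \<and> w = E i ! p)" for v w
    define h where "h v = (if \<exists>w. ok v w then SOME w. ok v w else v)" for v
    have ok_base: "w \<in> base q" if vw: "ok v w" for v w
    proof -
      obtain i xs p where "i \<in> I" "xs \<in> rels q i" "p < \<delta> i" "w = E i ! p" using vw unfolding ok_def by blast
      then have "E i \<in> rels q i" using E by blast
      then show ?thesis using is_structureD(4,5)[OF q, of "E i" i] \<open>p < \<delta> i\<close> \<open>w = E i ! p\<close> by auto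
    qed
    have h_nth: "h (xs ! p) = E i ! p" if xp: "i \<in> I" "xs \<in> rels q i" "p < \<delta> i" for i xs p
    proof -
      have "ok (xs ! p) (E i ! p)" using xp unfolding ok_def by blast
      then have "ok (xs ! p) (h (xs ! p))" unfolding h_def by (auto intro: someI)
      then obtain j ys r where "j \<in> I" "ys \<in> rels q j" "r < \<delta> j" "ys ! r = xs ! p" "h (xs ! p) = E j ! r"
        unfolding ok_def by blast
      then show ?thesis using uniq[of j i r p ys xs] xp unfolding junction_def by auto
    qed
    have "is_hom I h q X"
    proof (rule is_homI)
      fix v assume "v \<in> base q"
      then show "h v \<in> base X" using ok_base someI_ex[of "ok v"] by (auto simp: h_def base_X)
    next
      fix i xs assume i: "i \<in> I" and xs: "xs \<in> rels q i"
      have "E i \<in> rels q i" using E i xs by blast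
      then have "map h xs = E i"
        using h_nth[OF i xs] is_structureD(4)[OF q] xs by (intro nth_equalityI) auto
      then show "map h xs \<in> rels X i" using i xs by (auto simp: rels_X)
    qed
    then show ?thesis unfolding hom_to_def by blast
  qed
  have "sparse n (tups X)" for n
    unfolding sparse_def
  proof (intro allI impI)
    fix S assume S: "S \<subseteq> tups X" "S \<noteq> {}"
    have SX: "i \<in> I \<and> rels q i \<noteq> {} \<and> xs = E i" if "(i, xs) \<in> S" for i xs
      using S(1) that rels_X unfolding tups_def by blast
    obtain i xs where "(i, xs) \<in> S" using S(2) by auto
    then have i: "i \<in> I" "rels q i \<noteq> {}" "(i, E i) \<in> S" using SX by blast+
    have Ei: "E i \<in> rels q i" "length (E i) = \<delta> i" using E i is_structureD(4)[OF q] by blast+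
    have "distinct (E i)"
      unfolding distinct_conv_nth using same[OF i(1), of _ _ "E i" "E i"] Ei by (auto simp: junction_def)
    moreover have "\<exists>y. set (E i) \<inter> verts (S - {(i, E i)}) \<subseteq> {y}"
    proof -
      have meet: "\<exists>j a b. j \<in> I \<and> i \<noteq> j \<and> v = E i ! a \<and> junction q \<delta> i a j b (E i) (E j)"
        if v: "v \<in> set (E i)" "v \<in> verts (S - {(i, E i)})" for v
      proof -
        obtain u where u: "u \<in> S" "u \<noteq> (i, E i)" "v \<in> set (snd u)" using v(2) by blast
        obtain j xs where "u = (j, xs)" by (cases u)
        then have "(j, xs) \<in> S" "(j, xs) \<noteq> (i, E i)" "v \<in> set xs" using u by auto
        then have j: "j \<in> I" "j \<noteq> i" "E j \<in> rels q j" "v \<in> set (E j)"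
          using SX E by blast+
        obtain a where a: "a < \<delta> i" "v = E i ! a" using v(1) Ei(2) by (auto simp: in_set_conv_nth)
        obtain b where "b < \<delta> j" "v = E j ! b"
          using j(4) is_structureD(4)[OF q j(3)] by (auto simp: in_set_conv_nth)
        then have "junction q \<delta> i a j b (E i) (E j)" using a j(3) Ei(1) unfolding junction_def by simp
        then show ?thesis using a(2) j(1,2) by blast
      qed
      have "v = w" if v: "v \<in> set (E i)" "v \<in> verts (S - {(i, E i)})"
        and w: "w \<in> set (E i)" "w \<in> verts (S - {(i, E i)})" for v w
      proof -
        obtain j a b where j: "j \<in> I" "i \<noteq> j" "v = E i ! a" "junction q \<delta> i a j b (E i) (E j)"
          using meet[OF v] by blast
        obtain l c d where l: "l \<in> I" "i \<noteq> l" "w = E i ! c" "junction q \<delta> i c l d (E i) (E l)"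
          using meet[OF w] by blast
        have "l = j" using card_le_2_eq[OF I i(1) j(1,2)] l(1,2) by blast
        then show ?thesis using cross[OF i(1) j(1,2,4)] l(3,4) j(3) by blast
      qed
      then show ?thesis by blast
    qed
    ultimately have "\<exists>y. leaf S (i, E i) y" using i(3) unfolding leaf_def by auto
    then show "\<exists>e y. leaf S e y" by blast
  qed
  then have "forestlike I \<delta> q" using forestlike_if_sparse[OF q X I(1) pos qX Xq] by blast
  then show False using not_forest by blast
qed

lemma tups_dsum: "tups (dsum A B) = map_tup Inl ` tups A \<union> map_tup Inr ` tups B"
  by (auto simp: tups_def dsum_def map_tup_def image_iff)

lemma sparse_dsum: "sparse n (tups A) \<Longrightarrow> sparse n (tups B) \<Longrightarrow> sparse n (tups (dsum A B))"
  unfolding tups_dsum by (intro sparse_Un sparse_image) (auto simp: map_tup_def)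

text \<open>The property of representatives of a finite maximal antichain that the structural arguments use.\<close>
definition maximal_family :: "'i set \<Rightarrow> ('i \<Rightarrow> nat) \<Rightarrow> (nat, 'i) struct set \<Rightarrow> bool" where
  "maximal_family I \<delta> R \<longleftrightarrow> finite R \<and> (\<forall>q\<in>R. is_structure I \<delta> q) \<and>
    (\<forall>q\<in>R. \<forall>r\<in>R. hom_to I q r \<longrightarrow> q = r) \<and>
    (\<forall>A :: (nat, 'i) struct. is_structure I \<delta> A \<longrightarrow> (\<exists>q\<in>R. hom_to I A q \<or> hom_to I q A))"

text \<open>Were \<open>q\<close> to have a potential, the sum of a sparse structure \<open>X\<close> below \<open>q\<close> only and of the zigzag
  of \<open>q\<close> would be below no member of the family. A member above which it lies is small, so its part in
  the zigzag folds onto the junctions. This places it below \<open>q\<close>, and makes \<open>q\<close> a forest.\<close>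
lemma no_potential:
  fixes q :: "(nat, 'i) struct"
  assumes I: "finite I" "card I \<le> 2" and pos: "\<And>i. i \<in> I \<Longrightarrow> \<delta> i \<ge> 2"
    and st: "separating I \<delta> st"
    and R: "maximal_family I \<delta> R" and qR: "q \<in> R" and not_forest: "\<not> forestlike I \<delta> q"
  shows "\<not> has_potential I \<delta> st q"
proof
  assume pot: "has_potential I \<delta> st q"
  have Rs: "finite R" "\<And>r. r \<in> R \<Longrightarrow> is_structure I \<delta> r"
    "\<And>r s. r \<in> R \<Longrightarrow> s \<in> R \<Longrightarrow> hom_to I r s \<Longrightarrow> r = s"
    "\<And>A :: (nat, 'i) struct. is_structure I \<delta> A \<Longrightarrow> \<exists>r\<in>R. hom_to I A r \<or> hom_to I r A"
    using R unfolding maximal_family_def by blast+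
  obtain i j a b a' b' e f e' f' where J: "i \<in> I" "j \<in> I" "junction q \<delta> i a j b e f"
    "junction q \<delta> i a' j b' e' f'" "st i * (int a - int a') \<noteq> st j * (int b - int b')"
    using forestlike_or_junctions[OF Rs(2)[OF qR] I pos st not_forest] by blast
  interpret Jp: junction_pair I \<delta> q st i j a b a' b' "\<lambda>t. if t = 0 then e else e'" "\<lambda>t. if t = 0 then f else f'"
    using J pos Rs(2)[OF qR] unfolding junction_def by unfold_locales auto
  define n where "n = (\<Sum>r\<in>R. card (tups r))"
  have n: "card (tups r) \<le> n" if "r \<in> R" for r
    unfolding n_def by (rule member_le_sum[OF that]) (simp_all add: Rs(1))
  obtain X :: "(nat, 'i) struct" where X: "is_structure I \<delta> X" "hom_to I X q" "sparse n (tups X)"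
    "\<And>r. r \<in> R - {q} \<Longrightarrow> \<not> hom_to I X r"
    using sparse_incomparability[OF I(1) pos Rs(2)[OF qR], of "R - {q}" n] Rs(1-3) qR by blast
  obtain Y :: "(nat, 'i) struct" where Y: "is_structure I \<delta> Y"
    "hom_to I (dsum X (Jp.zigzag (n + 2))) Y" "hom_to I Y (dsum X (Jp.zigzag (n + 2)))"
    using nat_copy[OF dsum_structure[OF X(1) Jp.zigzag_structure]] by blast
  obtain r where r: "r \<in> R" "hom_to I Y r \<or> hom_to I r Y" using Rs(4)[OF Y(1)] by blast
  from r(2) show False
  proof
    assume "hom_to I Y r"
    then have "hom_to I X r" "hom_to I (Jp.zigzag (n + 2)) r"
      using hom_to_trans[OF Y(2)] unfolding hom_to_dsum by blast+
    moreover have "r = q" using X(4) r(1) calculation(1) by blast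
    ultimately have "has_potential I \<delta> st (Jp.zigzag (n + 2))" using has_potential_hom pot by blast
    then show False using Jp.zigzag_no_potential by simp
  next
    assume "hom_to I r Y"
    then have "hom_to I r (dsum X (Jp.zigzag (n + 2)))" using hom_to_trans Y(3) by blast
    then obtain h where h: "is_hom I h r (dsum X (Jp.zigzag (n + 2)))" unfolding hom_to_def by blast
    define S where "S = {u \<in> tups (Jp.zigzag (n + 2)). map_tup Inr u \<in> map_tup h ` tups r}"
    have fin: "finite (tups r)" by (rule finite_tups[OF Rs(2)[OF r(1)] I(1)])
    have inj: "inj_on (map_tup (Inr :: _ \<Rightarrow> nat + _)) S"
      by (rule inj_on_map_tup) simp
    have im: "map_tup Inr ` S \<subseteq> map_tup h ` tups r" unfolding S_def by blast
    have "finite S" using finite_imageD[OF finite_subset[OF im] inj] fin by simp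
    moreover have "card S \<le> n"
      using card_mono[OF _ im] card_image[OF inj] card_image_le[OF fin, of "map_tup h"] n[OF r(1)] fin by simp
    moreover have "S \<subseteq> tups (Jp.zigzag (n + 2))" unfolding S_def by blast
    ultimately obtain g where g: "\<forall>v\<in>base (Jp.zigzag (n + 2)). g v \<in> base Jp.junctions" "map_tup g ` S \<subseteq> tups Jp.junctions"
      using Jp.zigzag_local by blast
    have "is_hom I (map_sum id g \<circ> h) r (dsum X Jp.junctions)"
    proof (rule is_homI)
      fix v assume "v \<in> base r"
      then have "h v \<in> base (dsum X (Jp.zigzag (n + 2)))" by (rule is_hom_base[OF h])
      then show "(map_sum id g \<circ> h) v \<in> base (dsum X Jp.junctions)" using g(1) by (auto simp: dsum_def)
    next
      fix l xs assume l: "l \<in> I" and xs: "xs \<in> rels r l"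
      have "map h xs \<in> rels (dsum X (Jp.zigzag (n + 2))) l" by (rule is_hom_rels[OF h l xs])
      then consider ys where "ys \<in> rels X l" "map h xs = map Inl ys"
        | ys where "ys \<in> rels (Jp.zigzag (n + 2)) l" "map h xs = map Inr ys" by (auto simp: dsum_def)
      then show "map (map_sum id g \<circ> h) xs \<in> rels (dsum X Jp.junctions) l"
      proof cases
        case 1
        have "map (map_sum id g \<circ> h) xs = map (map_sum id g) (map Inl ys)" by (simp flip: 1(2))
        also have "\<dots> = map Inl ys" by simp
        finally show ?thesis using 1(1) by (simp add: dsum_def)
      next
        case 2
        have "map_tup h (l, xs) \<in> map_tup h ` tups r" using xs by (intro imageI) (simp add: tups_def)
        then have "(l, ys) \<in> S" using 2 by (simp add: S_def tups_def)
        then have "map_tup g (l, ys) \<in> tups Jp.junctions" using g(2) by blast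
        then have "map g ys \<in> rels Jp.junctions l" by (simp add: tups_def)
        moreover have "map (map_sum id g \<circ> h) xs = map (map_sum id g) (map Inr ys)" by (simp flip: 2(2))
        then have "map (map_sum id g \<circ> h) xs = map Inr (map g ys)" by simp
        ultimately show ?thesis unfolding dsum_def struct.sel by (metis UnCI imageI)
      qed
    qed
    then have rXP: "hom_to I r (dsum X Jp.junctions)" unfolding hom_to_def by blast
    have XPq: "hom_to I (dsum X Jp.junctions) q" using X(2) Jp.junctions_to_q by (simp add: hom_to_dsum)
    have "r = q" using Rs(3)[OF r(1) qR] hom_to_trans[OF rXP XPq] by blast
    then have "forestlike I \<delta> q"
      using forestlike_if_sparse[OF Rs(2)[OF qR] dsum_structure[OF X(1) Jp.junctions_structure] I(1) pos _ XPq
          sparse_dsum[OF X(3) Jp.junctions_sparse]] rXP n[OF qR] by blast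
    then show False using not_forest by blast
  qed
qed

text \<open>A structure \<open>X\<close> of large girth that is below \<open>D\<close> and below no member of the family can only be
  above members that map to forests without being forests, and these do not exist.\<close>
lemma maximal_dual_in_family:
  fixes D :: "(nat, 'i) struct"
  assumes I: "finite I" "card I \<le> 2" and pos: "\<And>i. i \<in> I \<Longrightarrow> \<delta> i \<ge> 2"
    and R: "maximal_family I \<delta> R" and D: "is_structure I \<delta> D"
    and DF: "\<And>F. F \<in> R \<Longrightarrow> forestlike I \<delta> F \<Longrightarrow> \<not> hom_to I D F \<and> \<not> hom_to I F D"
    and max: "\<And>A :: (nat, 'i) struct. is_structure I \<delta> A \<Longrightarrow> hom_to I D A \<Longrightarrow>
      (\<And>F. F \<in> R \<Longrightarrow> forestlike I \<delta> F \<Longrightarrow> \<not> hom_to I F A) \<Longrightarrow> hom_to I A D"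
  shows "\<exists>q\<in>R. hom_to I q D \<and> hom_to I D q"
proof (rule ccontr)
  assume none: "\<not> ?thesis"
  have Rs: "finite R" "\<And>r. r \<in> R \<Longrightarrow> is_structure I \<delta> r"
    "\<And>r s. r \<in> R \<Longrightarrow> s \<in> R \<Longrightarrow> hom_to I r s \<Longrightarrow> r = s"
    "\<And>A :: (nat, 'i) struct. is_structure I \<delta> A \<Longrightarrow> \<exists>r\<in>R. hom_to I A r \<or> hom_to I r A"
    using R unfolding maximal_family_def by blast+
  obtain st where st: "separating I \<delta> st" using separating_exists[of I \<delta>, OF I pos] by blast
  have D_not: "\<not> hom_to I D r" if r: "r \<in> R" for r
  proof
    assume Dr: "hom_to I D r"
    then have nf: "\<not> forestlike I \<delta> r" using DF r by blast
    then have "hom_to I r D" using max[OF Rs(2)[OF r] Dr] Rs(3)[OF _ r] by blast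
    then show False using none r Dr by blast
  qed
  define n where "n = (\<Sum>r\<in>R. card (tups r))"
  have n: "card (tups r) \<le> n" if "r \<in> R" for r
    unfolding n_def by (rule member_le_sum[OF that]) (simp_all add: Rs(1))
  obtain X :: "(nat, 'i) struct" where X: "is_structure I \<delta> X" "hom_to I X D" "sparse n (tups X)"
    "\<And>r. r \<in> R \<Longrightarrow> \<not> hom_to I X r"
    using sparse_incomparability[OF I(1) pos D, of R n] Rs(1,2) D_not by blast
  obtain r where r: "r \<in> R" "hom_to I r X" using Rs(4)[OF X(1)] X(4) by blast
  have "\<not> forestlike I \<delta> r" using DF r hom_to_trans[OF r(2) X(2)] by blast
  moreover have "has_potential I \<delta> st r"
    by (rule potential_if_sparse[OF Rs(2)[OF r(1)] X(1) I(1) pos r(2) X(3) n[OF r(1)]])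
  ultimately show False using no_potential[OF I pos st R r(1)] by blast
qed

section \<open>Cores and their isomorphism classes\<close>

lemma core_endo_surj:
  assumes A: "is_structure I \<delta> A" and core: "is_core I A" and h: "is_hom I h A A"
  shows "h ` base A = base A"
proof (rule ccontr)
  assume ne: "h ` base A \<noteq> base A"
  have sub: "h ` base A \<subset> base A" using ne is_hom_base[OF h] by blast
  have "is_hom I h A (induced A (h ` base A))"
  proof (rule is_homI)
    show "h v \<in> base (induced A (h ` base A))" if "v \<in> base A" for v
      using that by (simp add: induced_def)
    show "map h xs \<in> rels (induced A (h ` base A)) i" if "i \<in> I" "xs \<in> rels A i" for i xs
      using is_hom_rels[OF h that] is_structureD(5)[OF A that(2)] by (auto simp: induced_def)
  qed
  then have "hom_to I A (induced A (h ` base A))" unfolding hom_to_def by blast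
  moreover have "h ` base A \<noteq> {}" using is_structureD(2)[OF A] by simp
  ultimately have "\<exists>S. S \<noteq> {} \<and> S \<subset> base A \<and> hom_to I A (induced A S)"
    using sub by (intro exI[of _ "h ` base A"] conjI)
  with core[unfolded is_core_def] show False by (rule notE)
qed

text \<open>Both compositions are onto, hence the homomorphisms are bijective on vertices. They are injective on
  tuples, and counting tuples makes them onto there as well.\<close>
lemma equivalent_cores_iso:
  fixes A B :: "(nat, 'i) struct"
  assumes A: "is_structure I \<delta> A" "is_core I A" and B: "is_structure I \<delta> B" "is_core I B"
    and AB: "hom_to I A B" and BA: "hom_to I B A"
  shows "iso_class I \<delta> A = iso_class I \<delta> B"
proof -
  obtain f g where f: "is_hom I f A B" and g: "is_hom I g B A"
    using AB BA unfolding hom_to_def by blast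
  have gf: "(g \<circ> f) ` base A = base A" by (rule core_endo_surj[OF A is_hom_comp[OF f g]])
  have fg: "(f \<circ> g) ` base B = base B" by (rule core_endo_surj[OF B is_hom_comp[OF g f]])
  have "inj_on (g \<circ> f) (base A)" "inj_on (f \<circ> g) (base B)"
    using gf fg is_structureD(1) A(1) B(1) by (metis eq_card_imp_inj_on)+
  then have inj: "inj_on f (base A)" "inj_on g (base B)" by (auto intro: inj_on_imageI2)
  have "f ` base A \<subseteq> base B" "g ` base B \<subseteq> base A" using is_hom_base[OF f] is_hom_base[OF g] by blast+
  moreover have "base B \<subseteq> f ` g ` base B" using fg by (simp add: image_comp)
  ultimately have "f ` base A = base B" by blast
  then have bij: "bij_betw f (base A) (base B)" using inj(1) by (simp add: bij_betw_def)
  have map_inj: "inj_on (map k) (rels C i)"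
    if "is_structure I \<delta> C" "inj_on k (base C)" for k :: "nat \<Rightarrow> nat" and C :: "(nat, 'i) struct" and i
  proof (rule inj_onI)
    fix xs ys assume xs: "xs \<in> rels C i" and ys: "ys \<in> rels C i" and eq: "map k xs = map k ys"
    have "set xs \<union> set ys \<subseteq> base C"
      using is_structureD(5)[OF that(1) xs] is_structureD(5)[OF that(1) ys] by simp
    then show "xs = ys" by (rule map_inj_on[OF eq inj_on_subset[OF that(2)]])
  qed
  have "map f ` rels A i = rels B i" if i: "i \<in> I" for i
  proof (rule card_subset_eq)
    have fin: "finite (rels C i)" if C: "is_structure I \<delta> C" for C :: "(nat, 'i) struct"
      by (rule finite_subset[OF _ finite_lists_length_eq[OF is_structureD(1)[OF C], of "\<delta> i"]])
        (use is_structureD(4,5)[OF C] in blast)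
    show "finite (rels B i)" by (rule fin[OF B(1)])
    show sub: "map f ` rels A i \<subseteq> rels B i" using is_hom_rels[OF f i] by blast
    have "card (rels B i) = card (map g ` rels B i)"
      by (rule card_image[symmetric, OF map_inj[OF B(1) inj(2)]])
    also have "\<dots> \<le> card (rels A i)" using is_hom_rels[OF g i] by (intro card_mono fin[OF A(1)]) blast
    also have "\<dots> = card (map f ` rels A i)"
      by (rule card_image[symmetric, OF map_inj[OF A(1) inj(1)]])
    finally show "card (map f ` rels A i) = card (rels B i)"
      using card_mono[OF fin[OF B(1)] sub] by simp
  qed
  then have "is_iso I f A B" using bij by (simp add: is_iso_def)
  then have "(A, B) \<in> iso_rel I \<delta>" using A(1) B(1) by (auto simp: iso_rel_def)
  then show ?thesis unfolding iso_class_def by (rule equiv_class_eq[OF equiv_iso_rel])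
qed

text \<open>A retract with the fewest vertices is a core.\<close>
lemma core_exists:
  fixes A :: "(nat, 'i) struct"
  assumes A: "is_structure I \<delta> A"
  obtains C :: "(nat, 'i) struct"
  where "is_structure I \<delta> C" "is_core I C" "hom_to I A C" "hom_to I C A"
proof -
  define ok where "ok S \<longleftrightarrow> S \<subseteq> base A \<and> S \<noteq> {} \<and> hom_to I A (induced A S)" for S
  have "is_hom I id A (induced A (base A))"
    using is_structureD(5)[OF A] by (intro is_homI) (auto simp: induced_def)
  then have "ok (base A)" using is_structureD(2)[OF A] unfolding ok_def hom_to_def by blast
  then obtain S where S: "ok S" and min: "\<And>S'. ok S' \<Longrightarrow> card S \<le> card S'"
    using ex_has_least_nat[of ok _ card] by blast
  have S': "S \<subseteq> base A" "S \<noteq> {}" "hom_to I A (induced A S)" using S unfolding ok_def by blast+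
  have finS: "finite S" using S'(1) is_structureD(1)[OF A] finite_subset by blast
  have "is_structure I \<delta> (induced A S)"
    using is_structureD(3,4)[OF A] S'(2) finS by (intro is_structureI) (auto simp: induced_def)
  moreover have "is_hom I id (induced A S) A"
    using S'(1) by (intro is_homI) (auto simp: induced_def)
  then have "hom_to I (induced A S) A" unfolding hom_to_def by blast
  moreover have "is_core I (induced A S)"
    unfolding is_core_def
  proof
    assume "\<exists>T. T \<noteq> {} \<and> T \<subset> base (induced A S) \<and> hom_to I (induced A S) (induced (induced A S) T)"
    then obtain T where T: "T \<noteq> {}" "T \<subset> S" "hom_to I (induced A S) (induced (induced A S) T)"
      by (auto simp: induced_def)
    have "induced (induced A S) T = induced A T" using T(2) by (auto simp: induced_def fun_eq_iff)
    then have "ok T" using T S' hom_to_trans[OF S'(3)] unfolding ok_def by auto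
    then show False using min[of T] psubset_card_mono[OF finS T(2)] by simp
  qed
  ultimately show thesis using that S'(3) by blast
qed

definition rep :: "'i set \<Rightarrow> ('i \<Rightarrow> nat) \<Rightarrow> (nat, 'i) struct set \<Rightarrow> (nat, 'i) struct" where
  "rep I \<delta> X = (SOME A. is_structure I \<delta> A \<and> is_core I A \<and> X = iso_class I \<delta> A)"

lemma rep:
  assumes "X \<in> hom_order I \<delta>"
  shows "is_structure I \<delta> (rep I \<delta> X)" "is_core I (rep I \<delta> X)" "X = iso_class I \<delta> (rep I \<delta> X)"
proof -
  have "\<exists>A. is_structure I \<delta> A \<and> is_core I A \<and> X = iso_class I \<delta> A"
    using assms unfolding hom_order_def iso_class_def by (auto elim!: quotientE)
  from someI_ex[OF this] show "is_structure I \<delta> (rep I \<delta> X)" "is_core I (rep I \<delta> X)"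
    "X = iso_class I \<delta> (rep I \<delta> X)" unfolding rep_def by blast+
qed

lemma class_hom_rep:
  assumes "X \<in> hom_order I \<delta>" "Y \<in> hom_order I \<delta>"
  shows "class_hom I X Y \<longleftrightarrow> hom_to I (rep I \<delta> X) (rep I \<delta> Y)"
  using class_hom_iso_class[OF rep(1)[OF assms(1)] rep(1)[OF assms(2)]]
    rep(3)[OF assms(1)] rep(3)[OF assms(2)] by simp

lemma class_hom_rep_left:
  assumes "X \<in> hom_order I \<delta>" "is_structure I \<delta> A"
  shows "class_hom I X (iso_class I \<delta> A) \<longleftrightarrow> hom_to I (rep I \<delta> X) A"
  using class_hom_iso_class[OF rep(1)[OF assms(1)] assms(2)] rep(3)[OF assms(1)] by simp

lemma class_hom_rep_right:
  assumes "X \<in> hom_order I \<delta>" "is_structure I \<delta> A"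
  shows "class_hom I (iso_class I \<delta> A) X \<longleftrightarrow> hom_to I A (rep I \<delta> X)"
  using class_hom_iso_class[OF assms(2) rep(1)[OF assms(1)]] rep(3)[OF assms(1)] by simp

lemma class_antisym:
  assumes "X \<in> hom_order I \<delta>" "Y \<in> hom_order I \<delta>"
    and "hom_to I (rep I \<delta> X) (rep I \<delta> Y)" "hom_to I (rep I \<delta> Y) (rep I \<delta> X)"
  shows "X = Y"
  using equivalent_cores_iso[OF rep(1,2)[OF assms(1)] rep(1,2)[OF assms(2)] assms(3,4)]
    rep(3)[OF assms(1)] rep(3)[OF assms(2)] by simp

lemma class_exists:
  fixes A :: "(nat, 'i) struct"
  assumes "is_structure I \<delta> A"
  shows "\<exists>X\<in>hom_order I \<delta>. hom_to I A (rep I \<delta> X) \<and> hom_to I (rep I \<delta> X) A"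
proof -
  obtain C :: "(nat, 'i) struct"
    where C: "is_structure I \<delta> C" "is_core I C" "hom_to I A C" "hom_to I C A"
    using core_exists[OF assms] .
  define X where "X = iso_class I \<delta> C"
  have X: "X \<in> hom_order I \<delta>"
    using C(1,2) unfolding X_def hom_order_def iso_class_def by (intro quotientI) simp
  have "class_hom I X (iso_class I \<delta> C)" "class_hom I (iso_class I \<delta> C) X"
    using class_hom_iso_class[OF C(1) C(1)] hom_to_refl unfolding X_def by auto
  then have "hom_to I (rep I \<delta> X) C" "hom_to I C (rep I \<delta> X)"
    using class_hom_rep_left[OF X C(1)] class_hom_rep_right[OF X C(1)] by blast+
  then show ?thesis using X C(3,4) hom_to_trans[of I] by meson
qed

lemma maximal_antichain_family:
  fixes I :: "'i set"
  assumes max: "maximal_antichain I \<delta> Q" and fin: "finite Q"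
  shows "maximal_family I \<delta> (rep I \<delta> ` Q)"
proof -
  have anti: "Q \<subseteq> hom_order I \<delta>" "pairwise (incomparable I) Q"
    using max unfolding maximal_antichain_def antichain_def by blast+
  have eq: "rep I \<delta> X = rep I \<delta> Y" if "X \<in> Q" "Y \<in> Q" "hom_to I (rep I \<delta> X) (rep I \<delta> Y)" for X Y
  proof (rule ccontr)
    assume "rep I \<delta> X \<noteq> rep I \<delta> Y"
    then have "incomparable I X Y" using pairwiseD[OF anti(2) that(1,2)] by blast
    moreover have "class_hom I X Y"
      using class_hom_rep[OF subsetD[OF anti(1) that(1)] subsetD[OF anti(1) that(2)]] that(3) by simp
    ultimately show False unfolding incomparable_def by blast
  qed
  have comparable: "\<exists>X\<in>Q. hom_to I A (rep I \<delta> X) \<or> hom_to I (rep I \<delta> X) A"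
    if A: "is_structure I \<delta> A" for A :: "(nat, 'i) struct"
  proof (rule ccontr)
    assume no: "\<not> ?thesis"
    obtain C where C: "C \<in> hom_order I \<delta>" "hom_to I A (rep I \<delta> C)" "hom_to I (rep I \<delta> C) A"
      using class_exists[OF A] by blast
    have inc: "\<not> hom_to I (rep I \<delta> C) (rep I \<delta> X) \<and> \<not> hom_to I (rep I \<delta> X) (rep I \<delta> C)"
      if "X \<in> Q" for X using no that hom_to_trans[OF C(2)] hom_to_trans[OF _ C(3)] by blast
    then have "C \<notin> Q" using hom_to_refl by blast
    moreover have "antichain I \<delta> (insert C Q)"
      unfolding antichain_def
    proof
      show "insert C Q \<subseteq> hom_order I \<delta>" using C(1) anti(1) by blast
      have "incomparable I C X \<and> incomparable I X C" if X: "X \<in> Q" for X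
        using inc[OF X] class_hom_rep[OF C(1), of X] class_hom_rep[OF _ C(1), of X] anti(1) X
        unfolding incomparable_def by blast
      then show "pairwise (incomparable I) (insert C Q)" using anti(2) by (simp add: pairwise_insert)
    qed
    ultimately show False using max unfolding maximal_antichain_def by blast
  qed
  show ?thesis
    unfolding maximal_family_def
  proof (intro conjI ballI allI impI)
    show "finite (rep I \<delta> ` Q)" using fin by simp
    fix q assume q: "q \<in> rep I \<delta> ` Q"
    then obtain X where X: "X \<in> Q" "q = rep I \<delta> X" by blast
    then show "is_structure I \<delta> q" using rep(1)[OF subsetD[OF anti(1) X(1)]] by simp
    fix r assume "r \<in> rep I \<delta> ` Q" "hom_to I q r"
    then show "q = r" using eq X by blast
  next
    fix A :: "(nat, 'i) struct" assume "is_structure I \<delta> A"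
    then show "\<exists>q\<in>rep I \<delta> ` Q. hom_to I A q \<or> hom_to I q A" using comparable by blast
  qed
qed

lemma finite_preorder_maximal:
  fixes \<D> :: "(nat, 'i) struct set"
  assumes "finite \<D>" "D \<in> \<D>"
  shows "\<exists>E\<in>\<D>. hom_to I D E \<and> (\<forall>E'\<in>\<D>. hom_to I E E' \<longrightarrow> hom_to I E' E)"
proof -
  define up where "up E = {E' \<in> \<D>. hom_to I E E'}" for E :: "(nat, 'i) struct"
  \<comment> \<open>The order is a preorder only, so maximality is obtained by minimising the number of upper bounds.\<close>
  obtain E where E: "E \<in> up D" and min: "\<And>E'. E' \<in> up D \<Longrightarrow> card (up E) \<le> card (up E')"
    using ex_has_least_nat[of "\<lambda>E. E \<in> up D" D "\<lambda>E. card (up E)"] hom_to_refl assms(2)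
    unfolding up_def by blast
  have "hom_to I E' E" if E': "E' \<in> \<D>" "hom_to I E E'" for E'
  proof -
    have "up E' \<subseteq> up E" using hom_to_trans[OF E'(2)] unfolding up_def by blast
    moreover have "E' \<in> up D" using E E' hom_to_trans[of I D E E'] unfolding up_def by blast
    ultimately have "up E' = up E" using min[of E'] assms(1) by (intro card_seteq) (auto simp: up_def)
    moreover have "E \<in> up E" using E hom_to_refl unfolding up_def by blast
    ultimately show ?thesis unfolding up_def by blast
  qed
  then show ?thesis using E unfolding up_def by blast
qed

section \<open>Maximal antichains and dualities\<close>

lemma duality_maximal_antichain:
  assumes dual: "finite_duality I \<delta> \<F> \<D>"
  defines "Q \<equiv> \<F> \<union> {D \<in> \<D>. \<forall>F\<in>\<F>. \<not> class_hom I D F}"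
  shows "finite Q" "maximal_antichain I \<delta> Q"
proof -
  have fin: "finite \<F>" "finite \<D>" and sub: "\<F> \<subseteq> hom_order I \<delta>" "\<D> \<subseteq> hom_order I \<delta>"
    and inc: "pairwise (incomparable I) \<F>" "pairwise (incomparable I) \<D>"
    and dua: "\<And>A. is_structure I \<delta> A \<Longrightarrow> (\<exists>F\<in>\<F>. class_hom I F (iso_class I \<delta> A)) \<longleftrightarrow>
      (\<forall>D\<in>\<D>. \<not> class_hom I (iso_class I \<delta> A) D)"
    using dual unfolding finite_duality_def by blast+
  show "finite Q" using fin by (simp add: Q_def)
  have dua': "(\<exists>F\<in>\<F>. class_hom I F X) \<longleftrightarrow> (\<forall>D\<in>\<D>. \<not> class_hom I X D)" if "X \<in> hom_order I \<delta>" for X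
    using dua[OF rep(1)[OF that]] rep(3)[OF that] by simp
  have refl: "class_hom I X X" if "X \<in> hom_order I \<delta>" for X
    using class_hom_rep[OF that that] hom_to_refl by blast
  have FD: "\<not> class_hom I F D" if "F \<in> \<F>" "D \<in> \<D>" for F D
    using dua'[of D] refl[of D] that sub by blast
  have Qsub: "Q \<subseteq> hom_order I \<delta>" using sub by (auto simp: Q_def)
  have "pairwise (incomparable I) Q"
  proof (rule pairwiseI)
    fix X Y assume XY: "X \<in> Q" "Y \<in> Q" "X \<noteq> Y"
    consider "X \<in> \<F>" "Y \<in> \<F>" | "X \<in> \<D>" "Y \<in> \<D>"
      | "X \<in> \<F>" "Y \<in> \<D>" "\<not> class_hom I Y X" | "X \<in> \<D>" "Y \<in> \<F>" "\<not> class_hom I X Y"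
      using XY(1,2) unfolding Q_def by blast
    then show "incomparable I X Y"
      by cases (use inc FD XY(3) in \<open>auto simp: incomparable_def dest: pairwiseD\<close>)
  qed
  then have anti: "antichain I \<delta> Q" using Qsub by (simp add: antichain_def)
  have comparable: "\<exists>X\<in>Q. class_hom I X Y \<or> class_hom I Y X" if Y: "Y \<in> hom_order I \<delta>" for Y
  proof (cases "\<exists>F\<in>\<F>. class_hom I F Y")
    case True
    then show ?thesis by (auto simp: Q_def)
  next
    case False
    then obtain D where D: "D \<in> \<D>" "class_hom I Y D" using dua'[OF Y] by blast
    show ?thesis
    proof (cases "\<exists>F\<in>\<F>. class_hom I D F")
      case True
      then obtain F where F: "F \<in> \<F>" "class_hom I D F" by blast
      have "D \<in> hom_order I \<delta>" "F \<in> hom_order I \<delta>" using D F sub by blast+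
      then have "class_hom I Y F" using D(2) F(2) Y hom_to_trans by (simp add: class_hom_rep) blast
      then show ?thesis using F(1) by (auto simp: Q_def)
    next
      case False
      then show ?thesis using D by (auto simp: Q_def)
    qed
  qed
  have "\<not> (antichain I \<delta> Q' \<and> Q \<subset> Q')" for Q'
  proof
    assume Q': "antichain I \<delta> Q' \<and> Q \<subset> Q'"
    then obtain Y where Y: "Y \<in> Q'" "Y \<notin> Q" by blast
    then have "Y \<in> hom_order I \<delta>" using Q' unfolding antichain_def by blast
    then obtain X where X: "X \<in> Q" "class_hom I X Y \<or> class_hom I Y X" using comparable by blast
    then have "X \<in> Q'" "X \<noteq> Y" using Q' Y by blast+
    moreover have "pairwise (incomparable I) Q'" using Q' unfolding antichain_def by blast
    ultimately have "incomparable I X Y" using Y(1) by (blast dest: pairwiseD)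
    then show False using X(2) unfolding incomparable_def by blast
  qed
  then show "maximal_antichain I \<delta> Q" using anti unfolding maximal_antichain_def by blast
qed

lemma maximal_antichain_duality:
  fixes I :: "'i set" and \<delta> :: "'i \<Rightarrow> nat"
  assumes I: "finite I" "card I \<le> 2" and pos: "\<And>i. i \<in> I \<Longrightarrow> \<delta> i \<ge> 2"
    and Q: "finite Q" "maximal_antichain I \<delta> Q"
  shows "\<exists>\<F> \<D>. finite_duality I \<delta> \<F> \<D> \<and> Q = \<F> \<union> {D \<in> \<D>. \<forall>F\<in>\<F>. \<not> class_hom I D F}"
proof -
  have sub: "Q \<subseteq> hom_order I \<delta>" and inc: "pairwise (incomparable I) Q"
    using Q(2) unfolding maximal_antichain_def antichain_def by blast+
  have R: "maximal_family I \<delta> (rep I \<delta> ` Q)" by (rule maximal_antichain_family[OF Q(2,1)])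
  define \<F> where "\<F> = {X \<in> Q. forestlike I \<delta> (rep I \<delta> X)}"
  have "\<exists>\<D>. is_dual I \<delta> (\<lambda>A. \<exists>F\<in>rep I \<delta> ` \<F>. hom_to I F A) \<D>"
    using Q(1) by (intro forest_set_duality) (auto simp: \<F>_def)
  then obtain \<D>0 where \<D>0: "is_dual I \<delta> (\<lambda>A. \<exists>F\<in>rep I \<delta> ` \<F>. hom_to I F A) \<D>0" ..
  have fin0: "finite \<D>0" and str0: "\<And>D. D \<in> \<D>0 \<Longrightarrow> is_structure I \<delta> D"
    and dual0: "\<And>A :: (nat, 'i) struct. is_structure I \<delta> A \<Longrightarrow>
      (\<exists>F\<in>\<F>. hom_to I (rep I \<delta> F) A) \<longleftrightarrow> (\<forall>D\<in>\<D>0. \<not> hom_to I A D)"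
    using \<D>0 unfolding is_dual_def by simp_all
  have "\<forall>D\<in>\<D>0. \<exists>X. X \<in> hom_order I \<delta> \<and> hom_to I D (rep I \<delta> X) \<and> hom_to I (rep I \<delta> X) D"
    using class_exists[OF str0] by blast
  from bchoice[OF this] obtain cc where cc: "\<And>D. D \<in> \<D>0 \<Longrightarrow> cc D \<in> hom_order I \<delta>"
    "\<And>D. D \<in> \<D>0 \<Longrightarrow> hom_to I D (rep I \<delta> (cc D))" "\<And>D. D \<in> \<D>0 \<Longrightarrow> hom_to I (rep I \<delta> (cc D)) D" by blast
  define Mx where "Mx = {D \<in> \<D>0. \<forall>D'\<in>\<D>0. hom_to I D D' \<longrightarrow> hom_to I D' D}"
  define \<D> where "\<D> = cc ` Mx"
  have Mx_sub: "Mx \<subseteq> \<D>0" by (auto simp: Mx_def)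
  have \<D>_sub: "\<D> \<subseteq> hom_order I \<delta>" using cc(1) Mx_sub by (auto simp: \<D>_def)
  have \<F>_sub: "\<F> \<subseteq> hom_order I \<delta>" "\<F> \<subseteq> Q" using sub by (auto simp: \<F>_def)
  have below: "(\<exists>D\<in>\<D>. hom_to I A (rep I \<delta> D)) \<longleftrightarrow> (\<exists>D\<in>\<D>0. hom_to I A D)" for A :: "(nat, 'i) struct"
  proof
    assume "\<exists>D\<in>\<D>. hom_to I A (rep I \<delta> D)"
    then show "\<exists>D\<in>\<D>0. hom_to I A D"
      using cc(3) Mx_sub hom_to_trans[of I A] unfolding \<D>_def by blast
  next
    assume "\<exists>D\<in>\<D>0. hom_to I A D"
    then obtain D where D: "D \<in> \<D>0" "hom_to I A D" by blast
    obtain E where E: "E \<in> Mx" "hom_to I D E"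
      using finite_preorder_maximal[OF fin0 D(1), of I] by (auto simp: Mx_def)
    have "hom_to I A (rep I \<delta> (cc E))"
      using hom_to_trans[OF hom_to_trans[OF D(2) E(2)] cc(2)] E(1) Mx_sub by blast
    then show "\<exists>D\<in>\<D>. hom_to I A (rep I \<delta> D)" using E(1) by (auto simp: \<D>_def)
  qed
  have dual: "(\<exists>F\<in>\<F>. hom_to I (rep I \<delta> F) A) \<longleftrightarrow> (\<forall>D\<in>\<D>. \<not> hom_to I A (rep I \<delta> D))"
    if "is_structure I \<delta> A" for A :: "(nat, 'i) struct"
    using dual0[OF that] below[of A] by blast
  have \<D>_max: "hom_to I (rep I \<delta> E) (rep I \<delta> D)"
    if DE: "D \<in> \<D>" "E \<in> \<D>" "hom_to I (rep I \<delta> D) (rep I \<delta> E)" for D E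
  proof -
    obtain D0 E0 where D0: "D0 \<in> Mx" "D = cc D0" and E0: "E0 \<in> Mx" "E = cc E0"
      using DE by (auto simp: \<D>_def)
    have mem: "D0 \<in> \<D>0" "E0 \<in> \<D>0" using D0 E0 Mx_sub by blast+
    have "hom_to I D0 E0"
      using hom_to_trans[OF hom_to_trans[OF cc(2)[OF mem(1)]] cc(3)[OF mem(2)]] DE(3) D0 E0 by blast
    then have "hom_to I E0 D0" using D0(1) mem unfolding Mx_def by blast
    then show ?thesis
      using hom_to_trans[OF hom_to_trans[OF cc(3)[OF mem(2)]] cc(2)[OF mem(1)]] D0 E0 by blast
  qed
  have dualQ: "finite_duality I \<delta> \<F> \<D>"
    unfolding finite_duality_def
  proof (intro conjI allI impI)
    show "finite \<F>" "finite \<D>" using Q(1) fin0 by (simp_all add: \<F>_def \<D>_def Mx_def)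
    show "\<F> \<subseteq> hom_order I \<delta>" "\<D> \<subseteq> hom_order I \<delta>" by fact+
    show "pairwise (incomparable I) \<F>" using inc \<F>_sub(2) by (rule pairwise_subset)
    show "pairwise (incomparable I) \<D>"
      unfolding pairwise_def incomparable_def
      using \<D>_max class_antisym[of _ I \<delta>] class_hom_rep[of _ I \<delta>] \<D>_sub by (meson subsetD)
    fix A :: "(nat, 'i) struct" assume A: "is_structure I \<delta> A"
    show "(\<exists>F\<in>\<F>. class_hom I F (iso_class I \<delta> A)) \<longleftrightarrow> (\<forall>D\<in>\<D>. \<not> class_hom I (iso_class I \<delta> A) D)"
      using dual[OF A] class_hom_rep_left[OF _ A] class_hom_rep_right[OF _ A] \<F>_sub(1) \<D>_sub
      by (meson subsetD)
  qed
  have dual_in_Q: "D \<in> Q" if D: "D \<in> \<D>" and DF: "\<forall>F\<in>\<F>. \<not> class_hom I D F" for D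
  proof -
    have Dh: "D \<in> hom_order I \<delta>" using D \<D>_sub by blast
    have "\<exists>q\<in>rep I \<delta> ` Q. hom_to I q (rep I \<delta> D) \<and> hom_to I (rep I \<delta> D) q"
    proof (rule maximal_dual_in_family[OF I pos R rep(1)[OF Dh]])
      fix F assume "F \<in> rep I \<delta> ` Q" "forestlike I \<delta> F"
      then obtain X where X: "X \<in> \<F>" "F = rep I \<delta> X" by (auto simp: \<F>_def)
      have "\<not> hom_to I (rep I \<delta> D) F" using DF X class_hom_rep[OF Dh] \<F>_sub(1) by blast
      moreover have "\<not> hom_to I F (rep I \<delta> D)"
        using dual[OF rep(1)[OF Dh]] D hom_to_refl X by blast
      ultimately show "\<not> hom_to I (rep I \<delta> D) F \<and> \<not> hom_to I F (rep I \<delta> D)" by blast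
    next
      fix A :: "(nat, 'i) struct"
      assume A: "is_structure I \<delta> A" and DA: "hom_to I (rep I \<delta> D) A"
        and no: "\<And>F. F \<in> rep I \<delta> ` Q \<Longrightarrow> forestlike I \<delta> F \<Longrightarrow> \<not> hom_to I F A"
      have "\<not> (\<exists>F\<in>\<F>. hom_to I (rep I \<delta> F) A)" using no by (auto simp: \<F>_def)
      then obtain E where E: "E \<in> \<D>" "hom_to I A (rep I \<delta> E)" using dual[OF A] by blast
      have "hom_to I (rep I \<delta> E) (rep I \<delta> D)" using \<D>_max[OF D E(1) hom_to_trans[OF DA E(2)]] .
      then show "hom_to I A (rep I \<delta> D)" using hom_to_trans[OF E(2)] by blast
    qed
    then obtain X where X: "X \<in> Q" "hom_to I (rep I \<delta> X) (rep I \<delta> D)" "hom_to I (rep I \<delta> D) (rep I \<delta> X)"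
      by blast
    have "X = D" using class_antisym[OF _ Dh X(2,3)] X(1) sub by blast
    then show ?thesis using X(1) by simp
  qed
  have "X \<in> \<D> \<and> (\<forall>F\<in>\<F>. \<not> class_hom I X F)" if X: "X \<in> Q" "X \<notin> \<F>" for X
  proof -
    have Xh: "X \<in> hom_order I \<delta>" using X sub by blast
    have inF: "\<not> class_hom I F X \<and> \<not> class_hom I X F" if "F \<in> \<F>" for F
    proof -
      have "F \<in> Q" "F \<noteq> X" using that X \<F>_sub(2) by blast+
      then show ?thesis using pairwiseD[OF inc _ X(1), of F] unfolding incomparable_def by blast
    qed
    then have "\<not> (\<exists>F\<in>\<F>. hom_to I (rep I \<delta> F) (rep I \<delta> X))"
      using class_hom_rep[OF _ Xh] \<F>_sub(1) by blast
    then obtain D where D: "D \<in> \<D>" "hom_to I (rep I \<delta> X) (rep I \<delta> D)" using dual[OF rep(1)[OF Xh]] by blast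
    have Dh: "D \<in> hom_order I \<delta>" using D(1) \<D>_sub by blast
    have "\<not> class_hom I D F" if F: "F \<in> \<F>" for F
    proof
      assume "class_hom I D F"
      then have "hom_to I (rep I \<delta> D) (rep I \<delta> F)" using class_hom_rep[OF Dh] F \<F>_sub(1) by blast
      then have "class_hom I X F" using hom_to_trans[OF D(2)] class_hom_rep[OF Xh] F \<F>_sub(1) by blast
      then show False using inF[OF F] by blast
    qed
    then have "D \<in> Q" using dual_in_Q[OF D(1)] by blast
    moreover have "class_hom I X D" using D(2) class_hom_rep[OF Xh Dh] by blast
    ultimately have "X = D" using pairwiseD[OF inc X(1), of D] unfolding incomparable_def by blast
    then show ?thesis using D(1) inF by blast
  qed
  then have "Q = \<F> \<union> {D \<in> \<D>. \<forall>F\<in>\<F>. \<not> class_hom I D F}"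
    using dual_in_Q \<F>_sub(2) by blast
  then show ?thesis using dualQ by blast
qed

theorem mainTheorem3:
  fixes I :: "'i set" and \<delta> :: "'i \<Rightarrow> nat"
  assumes "finite I" and "card I \<le> 2" and "\<And>i. i \<in> I \<Longrightarrow> \<delta> i \<ge> 2"
  shows "{Q. finite Q \<and> maximal_antichain I \<delta> Q} =
         {\<F> \<union> {D \<in> \<D>. \<forall>F\<in>\<F>. \<not> class_hom I D F} | \<F> \<D>. finite_duality I \<delta> \<F> \<D>}"
proof (intro set_eqI iffI)
  fix Q assume "Q \<in> {Q. finite Q \<and> maximal_antichain I \<delta> Q}"
  then have Q: "finite Q" "maximal_antichain I \<delta> Q" by simp_all
  have "\<exists>\<F> \<D>. finite_duality I \<delta> \<F> \<D> \<and> Q = \<F> \<union> {D \<in> \<D>. \<forall>F\<in>\<F>. \<not> class_hom I D F}"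
    by (rule maximal_antichain_duality[OF assms(1,2) _ Q]) (rule assms(3))
  then obtain \<F> \<D> where "finite_duality I \<delta> \<F> \<D>"
    "Q = \<F> \<union> {D \<in> \<D>. \<forall>F\<in>\<F>. \<not> class_hom I D F}" by (elim exE conjE)
  then show "Q \<in> {\<F> \<union> {D \<in> \<D>. \<forall>F\<in>\<F>. \<not> class_hom I D F} | \<F> \<D>. finite_duality I \<delta> \<F> \<D>}"
    by (intro CollectI exI[of _ \<F>] exI[of _ \<D>] conjI)
next
  fix Q assume "Q \<in> {\<F> \<union> {D \<in> \<D>. \<forall>F\<in>\<F>. \<not> class_hom I D F} | \<F> \<D>. finite_duality I \<delta> \<F> \<D>}"
  then obtain \<F> \<D> where Q: "Q = \<F> \<union> {D \<in> \<D>. \<forall>F\<in>\<F>. \<not> class_hom I D F}"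
    and dual: "finite_duality I \<delta> \<F> \<D>" by (elim CollectE exE conjE)
  show "Q \<in> {Q. finite Q \<and> maximal_antichain I \<delta> Q}"
    unfolding Q using duality_maximal_antichain[OF dual] by simp
qed

end
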